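(* Let $\mathcal{G}$ be a groupoid with a length function $\ell$, and let $(\mathcal{G}^{(0)},\mathcal{R},\mu)$ be a probability measure space. Then the following are equivalent: (1) The groupoid $\mathcal{G}$ is asymptotically expanding in measure $\mu$. (2) The unit space $\mathcal{G}^{(0)}$ admits an exhaustion by domains $Y_n$ of $(C_n,N_n,L_n)$-expansion with ratio bounded by $\theta_n$, for some $C_n,N_n,L_n>0$ and $\theta_n\ge1$. (3) The unit space $\mathcal{G}^{(0)}$ admits an exhaustion by domains of asymptotic expansion.
   Context: Groupoids. A groupoid $\mathcal{G}$ (no topology assumed) has unit space $\mathcal{G}^{(0)}\subseteq\mathcal{G}$ and source and range maps $\mathrm{s},\mathrm{r}:\mathcal{G}\to\mathcal{G}^{(0)}$; $\gamma_1\gamma_2$ is defined when $\mathrm{s}(\gamma_1)=\mathrm{r}(\gamma_2)$. For $K\subseteq\mathcal{G}$ put $K^{-1}=\{\gamma^{-1}:\gamma\in K\}$; for $A\subseteq\mathcal{G}^{(0)}$, $\mathrm{r}(K\cdot A)=\{\mathrm{r}(\gamma):\gamma\in K,\mathrm{s}(\gamma)\in A\}$. $K$ is symmetric if $K=K^{-1}$, unital if $\mathcal{G}^{(0)}\subseteq K$, and a bisection if $\mathrm{s}|_K,\mathrm{r}|_K$ are injective; then $\tau_K:=\mathrm{r}|_K\circ(\mathrm{s}|_K)^{-1}:\mathrm{s}(K)\to\mathrm{r}(K)$. A length function is a map $\ell:\mathcal{G}\to[0,\infty)$ with $\ell=0$ on $\mathcal{G}^{(0)}$, $\ell(\gamma^{-1})=\ell(\gamma)$,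 and $\ell(\gamma_1\gamma_2)\le\ell(\gamma_1)+\ell(\gamma_2)$ for composable pairs; $\ell(K):=\sup_{\gamma\in K}\ell(\gamma)$. A bisection $K$ is admissible if $\mathrm{s}(K),\mathrm{r}(K)\in\mathcal{R}$, $\tau_K$ is a measurable isomorphism preserving the measure class of $\mu$ (it and its inverse send null sets to null sets), and $\ell(K)<\infty$. A subset is decomposable if it is a finite union of admissible bisections. For a unital symmetric decomposable $K$, a decomposition $K=\bigcup_{i=1}^N K_i$ into admissible bisections is unital if some $K_i=\mathcal{G}^{(0)}$, and symmetric if there is a bijection $\sigma$ of $\{1,\dots,N\}$ with $K_i^{-1}=K_{\sigma(i)}$. $K$ is $N$-decomposable if it has a unital symmetric decomposition into $N$ admissible bisections. A measurable $Y\subseteq\mathcal{G}^{(0)}$ is a domain of asymptotic expansion if for every $\alpha\in(0,\frac12]$ there are $C_\alpha,N_\alpha,L_\alpha>0$ and a unital symmetric $N_\alpha$-decomposable $K_\alpha\subseteq\mathcal{G}$ with $\ell(K_\alpha)\le L_\alpha$ such that $\mu((\mathrm{r}(K_\alpha\cdot A)\setminus A)\cap Y)>C_\alpha\mu(A)$ for all measurable $A\subseteq Y$ with $\alpha\mu(Y)\le\mu(A)\le\frac12\mu(Y)$. $\mathcal{G}$ is asymptotically expanding in measure $\mu$ if this holds with $Y=\mathcal{G}^{(0)}$. For an admissible bisection $K$ and $x\in\mathrm{s}(K)$, $\mathfrak{R}(K,x):=\frac{d(\tau_K^{-1})_*\mu|_{\mathrm{r}(K)}}{d\mu|_{\mathrm{s}(K)}}(x)$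 is the Radon–Nikodym derivative (defined up to null sets, and pointwise conditions on it are understood up to null sets), where $((\tau_K^{-1})_*\mu|_{\mathrm{r}(K)})(A)=\mu(\tau_K(A))$. A measurable $Y\subseteq\mathcal{G}^{(0)}$ is a domain of $(C,N,L)$-expansion with ratio bounded by $\theta\ge1$ if there is a unital symmetric $N$-decomposable $K$ with $\ell(K)\le L$ and a unital symmetric decomposition $K=\bigcup_{i=1}^N K_i$ into admissible bisections such that (i) $\mu((\mathrm{r}(K\cdot A)\setminus A)\cap Y)>C\mu(A)$ for all measurable $A\subseteq Y$ with $0<\mu(A)\le\frac12\mu(Y)$; (ii) $\frac1\theta\le\mathfrak{R}(K_i,x)\le\theta$ for all $x\in Y$ and all $i$ with $x\in\mathrm{s}(K_i)$ and $\tau_{K_i}(x)\in Y$. A sequence of measurable subsets $(Y_n)_{n\in\mathbb{N}}$ of $\mathcal{G}^{(0)}$ forms an exhaustion of $\mathcal{G}^{(0)}$ if $\lim_{n\to\infty}\mu(Y_n)=1$. *)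

theory Defs
  imports "HOL-Probability.Probability"
begin

text \<open>The unit space is a subset of the set of arrows. Composition \<open>mul G g h\<close> is only
  meaningful when \<open>src G g = rng G h\<close>.\<close>

record 'g groupoid_data =
  arrows :: "'g set"
  units :: "'g set"
  src :: "'g \<Rightarrow> 'g"
  rng :: "'g \<Rightarrow> 'g"
  mul :: "'g \<Rightarrow> 'g \<Rightarrow> 'g"
  ginv :: "'g \<Rightarrow> 'g"

locale groupoid =
  fixes G :: "'g groupoid_data"
  assumes units_subset: "units G \<subseteq> arrows G"
    and src_in_units: "g \<in> arrows G \<Longrightarrow> src G g \<in> units G"
    and rng_in_units: "g \<in> arrows G \<Longrightarrow> rng G g \<in> units G"
    and src_unit: "x \<in> units G \<Longrightarrow> src G x = x"
    and rng_unit: "x \<in> units G \<Longrightarrow> rng G x = x"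
    and mul_closed:
      "\<lbrakk>g \<in> arrows G; h \<in> arrows G; src G g = rng G h\<rbrakk> \<Longrightarrow> mul G g h \<in> arrows G"
    and src_mul:
      "\<lbrakk>g \<in> arrows G; h \<in> arrows G; src G g = rng G h\<rbrakk> \<Longrightarrow> src G (mul G g h) = src G h"
    and rng_mul:
      "\<lbrakk>g \<in> arrows G; h \<in> arrows G; src G g = rng G h\<rbrakk> \<Longrightarrow> rng G (mul G g h) = rng G g"
    and mul_assoc:
      "\<lbrakk>g \<in> arrows G; h \<in> arrows G; k \<in> arrows G; src G g = rng G h; src G h = rng G k\<rbrakk>
        \<Longrightarrow> mul G (mul G g h) k = mul G g (mul G h k)"
    and mul_src: "g \<in> arrows G \<Longrightarrow> mul G g (src G g) = g"
    and rng_mul_left: "g \<in> arrows G \<Longrightarrow> mul G (rng G g) g = g"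
    and ginv_closed: "g \<in> arrows G \<Longrightarrow> ginv G g \<in> arrows G"
    and src_ginv: "g \<in> arrows G \<Longrightarrow> src G (ginv G g) = rng G g"
    and rng_ginv: "g \<in> arrows G \<Longrightarrow> rng G (ginv G g) = src G g"
    and ginv_mul: "g \<in> arrows G \<Longrightarrow> mul G (ginv G g) g = src G g"
    and mul_ginv: "g \<in> arrows G \<Longrightarrow> mul G g (ginv G g) = rng G g"

definition length_function :: "'g groupoid_data \<Rightarrow> ('g \<Rightarrow> real) \<Rightarrow> bool" where
  "length_function G l \<longleftrightarrow>
     (\<forall>g\<in>arrows G. 0 \<le> l g) \<and>
     (\<forall>x\<in>units G. l x = 0) \<and>
     (\<forall>g\<in>arrows G. l (ginv G g) = l g) \<and>
     (\<forall>g\<in>arrows G. \<forall>h\<in>arrows G. src G g = rng G h \<longrightarrow> l (mul G g h) \<le> l g + l h)"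

text \<open>The supremum is taken in $[0,\infty]$, so the empty set has length 0.\<close>

definition set_length :: "('g \<Rightarrow> real) \<Rightarrow> 'g set \<Rightarrow> ennreal" where
  "set_length l K = (SUP g\<in>K. ennreal (l g))"

definition symmetric_subset :: "'g groupoid_data \<Rightarrow> 'g set \<Rightarrow> bool" where
  "symmetric_subset G K \<longleftrightarrow> K \<subseteq> arrows G \<and> K = ginv G ` K"

definition unital_subset :: "'g groupoid_data \<Rightarrow> 'g set \<Rightarrow> bool" where
  "unital_subset G K \<longleftrightarrow> K \<subseteq> arrows G \<and> units G \<subseteq> K"

definition bisection :: "'g groupoid_data \<Rightarrow> 'g set \<Rightarrow> bool" where
  "bisection G K \<longleftrightarrow> K \<subseteq> arrows G \<and> inj_on (src G) K \<and> inj_on (rng G) K"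

text \<open>The set $\mathrm{r}(K \cdot A)$.\<close>

definition rng_act :: "'g groupoid_data \<Rightarrow> 'g set \<Rightarrow> 'g set \<Rightarrow> 'g set" where
  "rng_act G K A = rng G ` {g \<in> K. src G g \<in> A}"

text \<open>For a bisection \<open>K\<close>, the map \<open>tau G K\<close> is only meaningful on \<open>src G ` K\<close> and
  \<open>tau_inv G K\<close> only on \<open>rng G ` K\<close>.\<close>

definition tau :: "'g groupoid_data \<Rightarrow> 'g set \<Rightarrow> 'g \<Rightarrow> 'g" where
  "tau G K x = rng G (the_inv_into K (src G) x)"

definition tau_inv :: "'g groupoid_data \<Rightarrow> 'g set \<Rightarrow> 'g \<Rightarrow> 'g" where
  "tau_inv G K = the_inv_into (src G ` K) (tau G K)"

text \<open>In what follows, the measure space \<open>M\<close> plays the role of $(\mathcal{G}^{(0)},\mathcal{R},\mu)$.\<close>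

definition admissible ::
  "'g groupoid_data \<Rightarrow> ('g \<Rightarrow> real) \<Rightarrow> 'g measure \<Rightarrow> 'g set \<Rightarrow> bool" where
  "admissible G l M K \<longleftrightarrow>
     bisection G K \<and>
     src G ` K \<in> sets M \<and> rng G ` K \<in> sets M \<and>
     tau G K \<in> restrict_space M (src G ` K) \<rightarrow>\<^sub>M restrict_space M (rng G ` K) \<and>
     tau_inv G K \<in> restrict_space M (rng G ` K) \<rightarrow>\<^sub>M restrict_space M (src G ` K) \<and>
     (\<forall>A\<in>null_sets M. A \<subseteq> src G ` K \<longrightarrow> tau G K ` A \<in> null_sets M) \<and>
     (\<forall>B\<in>null_sets M. B \<subseteq> rng G ` K \<longrightarrow> tau_inv G K ` B \<in> null_sets M) \<and>
     set_length l K < \<infinity>"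

definition decomposable ::
  "'g groupoid_data \<Rightarrow> ('g \<Rightarrow> real) \<Rightarrow> 'g measure \<Rightarrow> 'g set \<Rightarrow> bool" where
  "decomposable G l M K \<longleftrightarrow>
     (\<exists>\<K>. finite \<K> \<and> (\<forall>B\<in>\<K>. admissible G l M B) \<and> K = \<Union>\<K>)"

definition decomposition ::
  "'g groupoid_data \<Rightarrow> ('g \<Rightarrow> real) \<Rightarrow> 'g measure \<Rightarrow> nat \<Rightarrow> (nat \<Rightarrow> 'g set) \<Rightarrow> 'g set \<Rightarrow> bool" where
  "decomposition G l M N Ks K \<longleftrightarrow>
     (\<forall>i\<in>{1..N}. admissible G l M (Ks i)) \<and> K = (\<Union>i\<in>{1..N}. Ks i)"

definition unital_symmetric_decomposition ::
  "'g groupoid_data \<Rightarrow> ('g \<Rightarrow> real) \<Rightarrow> 'g measure \<Rightarrow> nat \<Rightarrow> (nat \<Rightarrow> 'g set) \<Rightarrow> 'g set \<Rightarrow> bool" where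
  "unital_symmetric_decomposition G l M N Ks K \<longleftrightarrow>
     decomposition G l M N Ks K \<and>
     (\<exists>i\<in>{1..N}. Ks i = units G) \<and>
     (\<exists>\<sigma>. bij_betw \<sigma> {1..N} {1..N} \<and> (\<forall>i\<in>{1..N}. ginv G ` Ks i = Ks (\<sigma> i)))"

definition N_decomposable ::
  "'g groupoid_data \<Rightarrow> ('g \<Rightarrow> real) \<Rightarrow> 'g measure \<Rightarrow> nat \<Rightarrow> 'g set \<Rightarrow> bool" where
  "N_decomposable G l M N K \<longleftrightarrow>
     unital_subset G K \<and> symmetric_subset G K \<and> decomposable G l M K \<and>
     (\<exists>Ks. unital_symmetric_decomposition G l M N Ks K)"

definition domain_of_asymptotic_expansion ::
  "'g groupoid_data \<Rightarrow> ('g \<Rightarrow> real) \<Rightarrow> 'g measure \<Rightarrow> 'g set \<Rightarrow> bool" where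
  "domain_of_asymptotic_expansion G l M Y \<longleftrightarrow>
     Y \<in> sets M \<and>
     (\<forall>\<alpha>::real. 0 < \<alpha> \<and> \<alpha> \<le> 1/2 \<longrightarrow>
       (\<exists>(C::real) (N::nat) (L::real) K.
          C > 0 \<and> N > 0 \<and> L > 0 \<and>
          N_decomposable G l M N K \<and> set_length l K \<le> ennreal L \<and>
          (\<forall>A\<in>sets M. A \<subseteq> Y \<and> \<alpha> * measure M Y \<le> measure M A \<and> measure M A \<le> 1/2 * measure M Y \<longrightarrow>
             measure M ((rng_act G K A - A) \<inter> Y) > C * measure M A)))"

definition asymptotically_expanding_in_measure ::
  "'g groupoid_data \<Rightarrow> ('g \<Rightarrow> real) \<Rightarrow> 'g measure \<Rightarrow> bool" where
  "asymptotically_expanding_in_measure G l M \<longleftrightarrow> domain_of_asymptotic_expansion G l M (units G)"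

text \<open>The measure $(\tau_K^{-1})_*\mu|_{\mathrm{r}(K)}$ on $\mathrm{s}(K)$; it sends \<open>A\<close> to
  $\mu(\tau_K(A))$.\<close>

definition pullback_measure :: "'g groupoid_data \<Rightarrow> 'g measure \<Rightarrow> 'g set \<Rightarrow> 'g measure" where
  "pullback_measure G M K =
     distr (restrict_space M (rng G ` K)) (restrict_space M (src G ` K)) (tau_inv G K)"

lemma bij_betw_tau:
  assumes "bisection G K"
  shows "bij_betw (tau G K) (src G ` K) (rng G ` K)"
proof -
  have s: "inj_on (src G) K" and r: "inj_on (rng G) K"
    using assms by (auto simp: bisection_def)
  have "bij_betw (rng G \<circ> the_inv_into K (src G)) (src G ` K) (rng G ` K)"
    using bij_betw_the_inv_into[OF inj_on_imp_bij_betw[OF s]] inj_on_imp_bij_betw[OF r]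
    by (rule bij_betw_trans)
  moreover have "rng G \<circ> the_inv_into K (src G) = tau G K"
    by (auto simp: tau_def fun_eq_iff)
  ultimately show ?thesis by simp
qed

lemma emeasure_pullback_measure:
  assumes K: "admissible G l M K" and A: "A \<in> sets M" "A \<subseteq> src G ` K"
  shows "emeasure (pullback_measure G M K) A = emeasure M (tau G K ` A)"
proof -
  let ?S = "src G ` K" and ?R = "rng G ` K"
  have S: "?S \<in> sets M" and R: "?R \<in> sets M"
    and m: "tau_inv G K \<in> restrict_space M ?R \<rightarrow>\<^sub>M restrict_space M ?S"
    and bij: "bij_betw (tau G K) ?S ?R"
    using K bij_betw_tau by (auto simp: admissible_def)
  have RM: "space (restrict_space M ?R) = ?R"
    using sets.sets_into_space[OF R] by (auto simp: space_restrict_space)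
  have A': "A \<in> sets (restrict_space M ?S)"
    using A S by (simp add: sets_restrict_space_iff)
  have inj: "inj_on (tau G K) ?S" and img: "tau G K ` ?S = ?R"
    using bij by (auto simp: bij_betw_def)
  have "tau_inv G K -` A \<inter> ?R = tau G K ` A"
  proof (intro equalityI subsetI)
    fix y assume y: "y \<in> tau_inv G K -` A \<inter> ?R"
    then have "tau G K (tau_inv G K y) = y"
      using f_the_inv_into_f[OF inj] img by (simp add: tau_inv_def)
    with y show "y \<in> tau G K ` A" by (metis IntD1 imageI vimageD)
  next
    fix y assume "y \<in> tau G K ` A"
    then obtain x where x: "x \<in> A" "y = tau G K x" by blast
    then have "tau_inv G K y = x"
      using the_inv_into_f_f[OF inj] A(2) by (auto simp: tau_inv_def)
    moreover have "y \<in> ?R"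
      unfolding img[symmetric] using x A(2) by blast
    ultimately show "y \<in> tau_inv G K -` A \<inter> ?R" using x by auto
  qed
  then have "emeasure (pullback_measure G M K) A = emeasure (restrict_space M ?R) (tau G K ` A)"
    using emeasure_distr[OF m A'] RM by (simp add: pullback_measure_def)
  also have "\<dots> = emeasure M (tau G K ` A)"
  proof (rule emeasure_restrict_space)
    show "?R \<inter> space M \<in> sets M" using R by simp
    show "tau G K ` A \<subseteq> ?R" unfolding img[symmetric] using A(2) by (rule image_mono)
  qed
  finally show ?thesis .
qed

definition rn_ratio :: "'g groupoid_data \<Rightarrow> 'g measure \<Rightarrow> 'g set \<Rightarrow> 'g \<Rightarrow> ennreal" where
  "rn_ratio G M K = RN_deriv (restrict_space M (src G ` K)) (pullback_measure G M K)"

text \<open>The pointwise bound on the Radon--Nikodym derivative is understood up to null sets.\<close>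

definition domain_of_expansion ::
  "'g groupoid_data \<Rightarrow> ('g \<Rightarrow> real) \<Rightarrow> 'g measure \<Rightarrow> real \<Rightarrow> nat \<Rightarrow> real \<Rightarrow> real \<Rightarrow> 'g set \<Rightarrow> bool" where
  "domain_of_expansion G l M C N L \<theta> Y \<longleftrightarrow>
     Y \<in> sets M \<and>
     (\<exists>K Ks. N_decomposable G l M N K \<and> set_length l K \<le> ennreal L \<and>
        unital_symmetric_decomposition G l M N Ks K \<and>
        (\<forall>A\<in>sets M. A \<subseteq> Y \<and> 0 < measure M A \<and> measure M A \<le> 1/2 * measure M Y \<longrightarrow>
           measure M ((rng_act G K A - A) \<inter> Y) > C * measure M A) \<and>
        (\<forall>i\<in>{1..N}. AE x in M. x \<in> Y \<and> x \<in> src G ` Ks i \<and> tau G (Ks i) x \<in> Y \<longrightarrow>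
           ennreal (1 / \<theta>) \<le> rn_ratio G M (Ks i) x \<and> rn_ratio G M (Ks i) x \<le> ennreal \<theta>))"

definition exhaustion :: "'g measure \<Rightarrow> (nat \<Rightarrow> 'g set) \<Rightarrow> bool" where
  "exhaustion M Y \<longleftrightarrow> (\<forall>n. Y n \<in> sets M) \<and> (\<lambda>n. measure M (Y n)) \<longlonglongrightarrow> 1"

end

theory Submission
  imports Defs
begin

text \<open>
  Write \<open>K A\<close> for \<open>rng_act G K A\<close>, call \<open>K A - A\<close> the boundary of \<open>A\<close>, and let \<open>\<mu>\<close> be the
  measure \<open>M\<close>. The whole argument is about the set map \<open>A \<mapsto> K A\<close>; since it preserves unions
  and, for an admissible bisection, measurable and null sets in both directions, the pointwise
  maps \<open>tau\<close> can be forgotten once admissibility has been rephrased in these terms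
  (\<open>admissible_iff\<close>).

  The tool used throughout is truncation. The Radon--Nikodym derivative of an admissible
  bisection is positive and finite almost everywhere with respect to the pulled back measure, so
  restricting the bisection to the set where it lies in \<open>[1/n, n]\<close> loses only an image of small
  measure (\<open>truncate_bisection\<close>, \<open>truncate_family\<close>). A finite union \<open>K\<close> of admissible bisections
  can thus be replaced by one with bounded ratios such that \<open>K A\<close> changes by at most \<open>\<eta>\<close>,
  uniformly in \<open>A\<close>. In particular \<open>A \<mapsto> \<mu> (K A)\<close> is uniformly absolutely continuous
  (\<open>rng_act_uniformly_absolutely_continuous\<close>).

  From asymptotic expansion to an exhaustion by domains of expansion
  (\<open>exists_domain_of_expansion\<close>): truncation turns expansion at scale \<open>\<alpha>\<close> into expansion at scale
  \<open>\<alpha>\<close> by bisections of bounded ratio. Adjoining inverses and units to such families for the two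
  scales \<open>1/4\<close> and a small \<open>\<alpha>\<close> gives a unital symmetric \<open>K\<close>. Among the sets of measure at most
  \<open>1/2\<close> whose boundary has at most \<open>c\<close> times their measure there is a maximal one, \<open>F\<close>; because of
  expansion at scale \<open>\<alpha>\<close> it has measure less than \<open>\<alpha>\<close>. On the complement \<open>Y\<close> of \<open>F\<close> every set
  \<open>A\<close> of positive measure that fills at most half of \<open>Y\<close> expands: otherwise \<open>A \<union> F\<close>
  would be a larger set with small boundary. Only if \<open>A \<union> F\<close> has measure above \<open>1/2\<close> does this reasoning fail, but then \<open>A\<close> is large and
  expands at scale \<open>1/4\<close> by an amount against which \<open>F\<close> is negligible.

  From an exhaustion to asymptotic expansion (\<open>asymptotically_expanding_if_domains\<close>): let \<open>Y\<close> be
  a domain with \<open>\<mu> Y\<close> close to \<open>1\<close>. If \<open>A\<close> fills at most half of \<open>Y\<close>, then \<open>A \<inter> Y\<close>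
  expands within \<open>Y\<close>. If it fills more, then \<open>Y - A\<close> expands into \<open>A\<close>; as \<open>K\<close> is symmetric, the
  part of \<open>A\<close> reached in this way is moved by \<open>K\<close> onto points outside \<open>A\<close>, and these have measure
  bounded below by uniform absolute continuity. A domain of expansion of positive measure is a
  domain of asymptotic expansion, so this covers both kinds of exhaustion.
\<close>

section \<open>Inverses and the action on sets of units\<close>

context groupoid
begin

lemma ginv_ginv:
  assumes g: "g \<in> arrows G"
  shows "ginv G (ginv G g) = g"
proof -
  let ?h = "ginv G g" and ?k = "ginv G (ginv G g)"
  have h: "?h \<in> arrows G" and k: "?k \<in> arrows G"
    using g by (auto intro: ginv_closed)
  have s: "src G ?k = src G g"
    using g h by (simp add: src_ginv rng_ginv)
  have "?k = mul G ?k (mul G ?h g)"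
    using mul_src[OF k] s g by (simp add: ginv_mul)
  also have "\<dots> = mul G (mul G ?k ?h) g"
    using g h k by (intro mul_assoc[symmetric]) (auto simp: src_ginv)
  also have "\<dots> = g"
    using g h by (simp add: ginv_mul src_ginv rng_mul_left)
  finally show ?thesis .
qed

lemma ginv_image_ginv_image: "K \<subseteq> arrows G \<Longrightarrow> ginv G ` ginv G ` K = K"
  by (force simp: image_image ginv_ginv subset_eq)

lemma ginv_image_units: "ginv G ` units G = units G"
proof -
  have "ginv G x = x" if "x \<in> units G" for x
  proof -
    have x: "x \<in> arrows G" using that units_subset by auto
    have "ginv G x = mul G (ginv G x) (src G (ginv G x))"
      using x by (simp add: mul_src ginv_closed)
    also have "\<dots> = mul G (ginv G x) x"
      using x that by (simp add: src_ginv rng_unit)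
    also have "\<dots> = x"
      using x that by (simp add: ginv_mul src_unit)
    finally show ?thesis .
  qed
  then show ?thesis by force
qed

lemma rng_act_ginv:
  assumes "K \<subseteq> arrows G"
  shows "rng_act G (ginv G ` K) A = src G ` {g \<in> K. rng G g \<in> A}"
proof -
  have "{h \<in> ginv G ` K. src G h \<in> A} = ginv G ` {g \<in> K. rng G g \<in> A}"
    using assms by (auto simp: src_ginv subset_eq)
  moreover have "rng G ` ginv G ` {g \<in> K. rng G g \<in> A} = src G ` {g \<in> K. rng G g \<in> A}"
    unfolding image_image using assms by (intro image_cong) (auto simp: rng_ginv)
  ultimately show ?thesis
    by (simp add: rng_act_def)
qed

lemma src_image_ginv: "K \<subseteq> arrows G \<Longrightarrow> src G ` ginv G ` K = rng G ` K"
  unfolding image_image by (intro image_cong) (auto simp: src_ginv)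

lemma rng_image_ginv: "K \<subseteq> arrows G \<Longrightarrow> rng G ` ginv G ` K = src G ` K"
  unfolding image_image by (intro image_cong) (auto simp: rng_ginv)

lemma bisection_ginv:
  assumes "bisection G K"
  shows "bisection G (ginv G ` K)"
proof -
  have K: "K \<subseteq> arrows G" and s: "inj_on (src G) K" and r: "inj_on (rng G) K"
    using assms by (auto simp: bisection_def)
  have "inj_on (src G \<circ> ginv G) K"
    using r K by (auto simp: inj_on_def src_ginv subset_eq)
  moreover have "inj_on (rng G \<circ> ginv G) K"
    using s K by (auto simp: inj_on_def rng_ginv subset_eq)
  ultimately show ?thesis
    using K by (auto simp: bisection_def ginv_closed dest: inj_on_imageI)
qed

end

lemma rng_act_mono: "K \<subseteq> K' \<Longrightarrow> A \<subseteq> A' \<Longrightarrow> rng_act G K A \<subseteq> rng_act G K' A'"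
  by (auto simp: rng_act_def)

lemma rng_act_Un: "rng_act G K (A \<union> B) = rng_act G K A \<union> rng_act G K B"
  by (auto simp: rng_act_def)

lemma rng_act_UN: "rng_act G K (\<Union>i\<in>I. A i) = (\<Union>i\<in>I. rng_act G K (A i))"
  by (auto simp: rng_act_def)

lemma rng_act_Union_left: "rng_act G (\<Union>\<B>) A = (\<Union>B\<in>\<B>. rng_act G B A)"
  by (auto simp: rng_act_def)

lemma rng_act_Int_src: "rng_act G K (A \<inter> src G ` K) = rng_act G K A"
  by (auto simp: rng_act_def)

lemma rng_act_subset: "rng_act G K A \<subseteq> rng G ` K"
  by (auto simp: rng_act_def)

lemma set_length_mono: "K \<subseteq> K' \<Longrightarrow> set_length l K \<le> set_length l K'"
  unfolding set_length_def by (rule SUP_subset_mono) auto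

lemma tau_src: "bisection G K \<Longrightarrow> g \<in> K \<Longrightarrow> tau G K (src G g) = rng G g"
  by (simp add: tau_def bisection_def the_inv_into_f_f)

lemma tau_inv_rng:
  assumes "bisection G K" "g \<in> K"
  shows "tau_inv G K (rng G g) = src G g"
proof -
  have "inj_on (tau G K) (src G ` K)"
    using bij_betw_tau[OF assms(1)] by (simp add: bij_betw_def)
  from the_inv_into_f_f[OF this, of "src G g"] show ?thesis
    using assms by (simp add: tau_inv_def tau_src)
qed

lemma tau_image:
  assumes "bisection G K" "A \<subseteq> src G ` K"
  shows "tau G K ` A = rng_act G K A"
proof (intro equalityI subsetI)
  fix y assume "y \<in> tau G K ` A"
  then obtain x where "x \<in> A" "y = tau G K x" by blast
  moreover then obtain g where "g \<in> K" "x = src G g" using assms by blast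
  ultimately show "y \<in> rng_act G K A"
    using assms by (auto simp: rng_act_def tau_src)
next
  fix y assume "y \<in> rng_act G K A"
  then obtain g where "g \<in> K" "src G g \<in> A" "y = rng G g"
    by (auto simp: rng_act_def)
  then show "y \<in> tau G K ` A"
    using tau_src[OF assms(1), of g] by (metis imageI)
qed

lemma tau_inv_vimage:
  assumes "bisection G K"
  shows "tau_inv G K -` A \<inter> rng G ` K = rng_act G K A"
  using assms by (auto simp: rng_act_def tau_inv_rng)

context groupoid
begin

lemma tau_inv_image:
  assumes K: "bisection G K" and A: "A \<subseteq> rng G ` K"
  shows "tau_inv G K ` A = rng_act G (ginv G ` K) A"
proof -
  have K': "K \<subseteq> arrows G" using K by (simp add: bisection_def)
  have "A = rng G ` {g \<in> K. rng G g \<in> A}"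
    using A by auto
  then have "tau_inv G K ` A = tau_inv G K ` rng G ` {g \<in> K. rng G g \<in> A}"
    by simp
  also have "\<dots> = src G ` {g \<in> K. rng G g \<in> A}"
    unfolding image_image by (intro image_cong) (auto simp: tau_inv_rng K)
  finally show ?thesis
    using K' by (simp add: rng_act_ginv)
qed

lemma tau_vimage:
  assumes "bisection G K"
  shows "tau G K -` A \<inter> src G ` K = rng_act G (ginv G ` K) A"
proof -
  have K': "K \<subseteq> arrows G" using assms by (simp add: bisection_def)
  show ?thesis
    unfolding rng_act_ginv[OF K'] using assms by (auto simp: tau_src)
qed

lemma rng_act_ginv_restrict:
  assumes "K \<subseteq> arrows G" "inj_on (src G) K"
  shows "rng_act G (ginv G ` {g \<in> K. src G g \<in> D}) A = rng_act G (ginv G ` K) A \<inter> D"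
proof -
  have "{g \<in> K. src G g \<in> D} \<subseteq> arrows G" using assms by auto
  then show ?thesis
    using assms by (auto simp: rng_act_ginv)
qed

end

section \<open>Maximal sets up to null sets\<close>

context finite_measure
begin

text \<open>A greedy exhaustion in place of Zorn's lemma: each set of an increasing sequence comes within
  \<open>1/(n+1)\<close> of the largest measure that an admitted superset of its predecessor can have, so no
  admitted superset of the union has larger measure.\<close>

lemma exists_maximal_set_up_to_null:
  assumes meas: "\<And>F. P F \<Longrightarrow> F \<in> sets M"
    and start: "P F\<^sub>0"
    and union: "\<And>F :: nat \<Rightarrow> 'a set. incseq F \<Longrightarrow> (\<And>n. P (F n)) \<Longrightarrow> P (\<Union>n. F n)"
  obtains F where "P F" "\<And>H. P H \<Longrightarrow> F \<subseteq> H \<Longrightarrow> measure M H \<le> measure M F"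
proof -
  have step: "\<exists>F'. P F' \<and> F \<subseteq> F' \<and> (\<forall>H. P H \<and> F \<subseteq> H \<longrightarrow> measure M H \<le> measure M F' + 1 / (real n + 1))"
    if "P F" for F and n :: nat
  proof -
    let ?X = "measure M ` {H. P H \<and> F \<subseteq> H}"
    have ne: "?X \<noteq> {}" using that by blast
    have bdd: "bdd_above ?X"
      by (rule bdd_aboveI2[of _ _ "measure M (space M)"]) (rule bounded_measure)
    have "Sup ?X - 1 / (real n + 1) < Sup ?X" by simp
    then obtain F' where F': "P F'" "F \<subseteq> F'" "Sup ?X - 1 / (real n + 1) < measure M F'"
      using less_cSup_iff[OF ne bdd] by auto
    moreover have "measure M H \<le> measure M F' + 1 / (real n + 1)" if "P H" "F \<subseteq> H" for H
      using cSup_upper[OF _ bdd, of "measure M H"] that F' by fastforce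
    ultimately show ?thesis by blast
  qed
  obtain F where F: "\<And>n. P (F n)"
    and F_step: "\<And>n. F n \<subseteq> F (Suc n) \<and>
      (\<forall>H. P H \<and> F n \<subseteq> H \<longrightarrow> measure M H \<le> measure M (F (Suc n)) + 1 / (real n + 1))"
    using dependent_nat_choice[of "\<lambda>_. P" "\<lambda>n F F'. F \<subseteq> F' \<and>
      (\<forall>H. P H \<and> F \<subseteq> H \<longrightarrow> measure M H \<le> measure M F' + 1 / (real n + 1))"] start step
    by metis
  have "incseq F"
    using F_step by (intro incseq_SucI) auto
  then have P: "P (\<Union>n. F n)"
    using F by (rule union)
  show thesis
  proof
    show "P (\<Union>n. F n)" by (fact P)
    fix H assume H: "P H" "(\<Union>n. F n) \<subseteq> H"
    show "measure M H \<le> measure M (\<Union>n. F n)"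
    proof (rule field_le_epsilon)
      fix e :: real assume "0 < e"
      then obtain n :: nat where n: "inverse (real (Suc n)) < e"
        using reals_Archimedean by blast
      have "measure M H \<le> measure M (F (Suc n)) + 1 / (real n + 1)"
        using F_step[of n] H by blast
      also have "measure M (F (Suc n)) \<le> measure M (\<Union>n. F n)"
        using P meas by (intro finite_measure_mono) auto
      finally show "measure M H \<le> measure M (\<Union>n. F n) + e"
        using n by (simp add: inverse_eq_divide add.commute)
    qed
  qed
qed

end

section \<open>Admissible bisections as set maps\<close>

locale measured_groupoid = groupoid G + prob_space M
  for G :: "'g groupoid_data" and M :: "'g measure" +
  fixes l :: "'g \<Rightarrow> real"
  assumes length: "length_function G l"
    and space_units: "space M = units G"

context measured_groupoid
begin

text \<open>Both measurability of the partial isomorphism and preservation of the measure class become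
  statements about the set maps of \<open>K\<close> and of its inverse, for arbitrary sets in place of subsets
  of source and range. In this form inverses, restrictions and unions are immediate.\<close>

lemma admissible_iff:
  "admissible G l M K \<longleftrightarrow>
     bisection G K \<and> src G ` K \<in> sets M \<and> rng G ` K \<in> sets M \<and>
     (\<forall>A\<in>sets M. rng_act G K A \<in> sets M \<and> rng_act G (ginv G ` K) A \<in> sets M) \<and>
     (\<forall>A\<in>null_sets M. rng_act G K A \<in> null_sets M \<and> rng_act G (ginv G ` K) A \<in> null_sets M) \<and>
     set_length l K < \<infinity>"
proof (cases "bisection G K \<and> src G ` K \<in> sets M \<and> rng G ` K \<in> sets M")
  case False
  then show ?thesis by (auto simp: admissible_def)
next
  case True
  then have K: "bisection G K" and S: "src G ` K \<in> sets M" and R: "rng G ` K \<in> sets M"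
    by auto
  have K': "K \<subseteq> arrows G" using K by (simp add: bisection_def)
  let ?S = "restrict_space M (src G ` K)" and ?R = "restrict_space M (rng G ` K)"
  have sp: "space ?S = src G ` K" "space ?R = rng G ` K"
    using sets.sets_into_space[OF S] sets.sets_into_space[OF R] by (auto simp: space_restrict_space)
  have st: "A \<in> sets ?S \<longleftrightarrow> A \<subseteq> src G ` K \<and> A \<in> sets M"
           "A \<in> sets ?R \<longleftrightarrow> A \<subseteq> rng G ` K \<and> A \<in> sets M" for A
    using S R by (auto simp: sets_restrict_space_iff)
  have cutS: "rng_act G K A = rng_act G K (A \<inter> src G ` K)" for A
    by (simp add: rng_act_Int_src)
  have cutR: "rng_act G (ginv G ` K) A = rng_act G (ginv G ` K) (A \<inter> rng G ` K)" for A
    using rng_act_Int_src[of G "ginv G ` K" A] by (simp add: src_image_ginv[OF K'])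
  have sub: "rng_act G (ginv G ` K) A \<subseteq> src G ` K" for A
    using rng_act_subset[of G "ginv G ` K" A] by (simp add: rng_image_ginv[OF K'])
  have tau_funcset: "tau G K \<in> src G ` K \<rightarrow> rng G ` K"
    using K by (auto simp: tau_src)
  have tau_inv_funcset: "tau_inv G K \<in> rng G ` K \<rightarrow> src G ` K"
    using K by (auto simp: tau_inv_rng)
  have 1: "tau G K \<in> ?S \<rightarrow>\<^sub>M ?R \<longleftrightarrow> (\<forall>A\<in>sets M. rng_act G (ginv G ` K) A \<in> sets M)"
    (is "?L \<longleftrightarrow> ?Q")
  proof
    assume ?L
    show ?Q
    proof
      fix A assume "A \<in> sets M"
      then have "A \<inter> rng G ` K \<in> sets ?R" using R by (simp add: st)
      from measurable_sets[OF \<open>?L\<close> this] show "rng_act G (ginv G ` K) A \<in> sets M"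
        unfolding sp tau_vimage[OF K] cutR[symmetric] by (simp add: st)
    qed
  next
    assume ?Q
    then show ?L
      using tau_funcset sub by (intro measurableI) (auto simp: sp st tau_vimage[OF K])
  qed
  have 2: "tau_inv G K \<in> ?R \<rightarrow>\<^sub>M ?S \<longleftrightarrow> (\<forall>A\<in>sets M. rng_act G K A \<in> sets M)"
    (is "?L \<longleftrightarrow> ?Q")
  proof
    assume ?L
    show ?Q
    proof
      fix A assume "A \<in> sets M"
      then have "A \<inter> src G ` K \<in> sets ?S" using S by (simp add: st)
      from measurable_sets[OF \<open>?L\<close> this] show "rng_act G K A \<in> sets M"
        unfolding sp tau_inv_vimage[OF K] cutS[symmetric] by (simp add: st)
    qed
  next
    assume ?Q
    then show ?L
      using tau_inv_funcset rng_act_subset[of G K]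
      by (intro measurableI) (auto simp: sp st tau_inv_vimage[OF K])
  qed
  have 3: "(\<forall>A\<in>null_sets M. A \<subseteq> src G ` K \<longrightarrow> tau G K ` A \<in> null_sets M) \<longleftrightarrow>
      (\<forall>A\<in>null_sets M. rng_act G K A \<in> null_sets M)"
    using cutS S by (metis Int_lower2 null_set_Int2 tau_image[OF K])
  have 4: "(\<forall>A\<in>null_sets M. A \<subseteq> rng G ` K \<longrightarrow> tau_inv G K ` A \<in> null_sets M) \<longleftrightarrow>
      (\<forall>A\<in>null_sets M. rng_act G (ginv G ` K) A \<in> null_sets M)"
    using cutR R by (metis Int_lower2 null_set_Int2 tau_inv_image[OF K])
  show ?thesis
    unfolding admissible_def 1 2 3 4 using K S R by auto
qed

lemma admissible_units: "admissible G l M (units G)"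
proof -
  have imgs: "src G ` units G = units G" "rng G ` units G = units G"
    using src_unit rng_unit by force+
  have act: "rng_act G (units G) A = A \<inter> units G" for A
    using src_unit rng_unit by (force simp: rng_act_def)
  have "set_length l (units G) \<le> 0"
    unfolding set_length_def using length
    by (intro SUP_least) (simp add: length_function_def)
  then have "set_length l (units G) < \<infinity>"
    by (simp add: le_zero_eq)
  moreover have "bisection G (units G)"
    using units_subset by (auto simp: bisection_def inj_on_def src_unit rng_unit)
  moreover have "units G \<in> sets M"
    by (simp flip: space_units)
  ultimately show ?thesis
    by (auto simp: admissible_iff ginv_image_units imgs act null_set_Int2)
qed

lemma set_length_ginv:
  assumes "K \<subseteq> arrows G"
  shows "set_length l (ginv G ` K) = set_length l K"
  unfolding set_length_def image_image
  using assms length by (intro SUP_cong) (auto simp: length_function_def subset_eq)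

lemma admissible_ginv:
  assumes "admissible G l M K"
  shows "admissible G l M (ginv G ` K)"
proof -
  have K: "K \<subseteq> arrows G" "bisection G K"
    using assms by (auto simp: admissible_iff bisection_def)
  show ?thesis
    using assms K
    by (auto simp: admissible_iff ginv_image_ginv_image src_image_ginv rng_image_ginv
        set_length_ginv bisection_ginv)
qed

lemma admissible_restrict:
  assumes K: "admissible G l M K" and D: "D \<in> sets M"
  shows "admissible G l M {g \<in> K. src G g \<in> D}"
proof -
  let ?K = "{g \<in> K. src G g \<in> D}"
  have arr: "K \<subseteq> arrows G" and inj: "inj_on (src G) K"
    using K by (auto simp: admissible_iff bisection_def)
  have "set_length l ?K \<le> set_length l K"
    by (rule set_length_mono) auto
  then have "set_length l ?K < \<infinity>"
    using K by (auto simp: admissible_iff intro: le_less_trans)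
  moreover have "bisection G ?K"
    using K by (auto simp: admissible_iff bisection_def intro: inj_on_subset)
  moreover have "src G ` ?K = src G ` K \<inter> D"
    by auto
  moreover have "rng G ` ?K = rng_act G K D"
    by (simp add: rng_act_def)
  moreover have "rng_act G ?K A = rng_act G K (A \<inter> D)" for A
    by (auto simp: rng_act_def)
  ultimately show ?thesis
    using K D by (auto simp: admissible_iff rng_act_ginv_restrict[OF arr inj] null_set_Int2)
qed

end

section \<open>Bounded Radon--Nikodym derivatives\<close>

text \<open>An integrated form of the bound on the Radon--Nikodym derivative. It has no exceptional null
  sets, and it is visibly invariant under inversion of \<open>K\<close>.\<close>

definition ratio_bounded :: "'g groupoid_data \<Rightarrow> 'g measure \<Rightarrow> real \<Rightarrow> 'g set \<Rightarrow> bool" where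
  "ratio_bounded G M \<theta> K \<longleftrightarrow>
     (\<forall>A\<in>sets M. A \<subseteq> src G ` K \<longrightarrow>
        measure M A \<le> \<theta> * measure M (rng_act G K A) \<and>
        measure M (rng_act G K A) \<le> \<theta> * measure M A)"

lemma ratio_bounded_mono:
  assumes "ratio_bounded G M \<theta> K" "\<theta> \<le> \<theta>'"
  shows "ratio_bounded G M \<theta>' K"
  unfolding ratio_bounded_def
proof (intro ballI impI)
  fix A assume "A \<in> sets M" "A \<subseteq> src G ` K"
  then have "measure M A \<le> \<theta> * measure M (rng_act G K A)"
      "measure M (rng_act G K A) \<le> \<theta> * measure M A"
    using assms(1) by (auto simp: ratio_bounded_def)
  moreover have "\<theta> * measure M B \<le> \<theta>' * measure M B" for B
    using assms(2) by (intro mult_right_mono) auto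
  ultimately show "measure M A \<le> \<theta>' * measure M (rng_act G K A) \<and>
      measure M (rng_act G K A) \<le> \<theta>' * measure M A"
    by (meson order_trans)
qed

text \<open>On the set where \<open>g < f\<close> the two integrals would be strictly ordered the wrong way.\<close>

lemma AE_le_if_set_nn_integral_le:
  fixes f g :: "'a \<Rightarrow> ennreal"
  assumes [measurable]: "f \<in> borel_measurable N" "g \<in> borel_measurable N"
    and fin: "(\<integral>\<^sup>+x. g x \<partial>N) < \<infinity>"
    and le: "\<And>A. A \<in> sets N \<Longrightarrow>
      (\<integral>\<^sup>+x. f x * indicator A x \<partial>N) \<le> (\<integral>\<^sup>+x. g x * indicator A x \<partial>N)"
  shows "AE x in N. f x \<le> g x"
proof -
  define A where "A = {x \<in> space N. g x < f x}"
  have A[measurable]: "A \<in> sets N" by (simp add: A_def)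
  have "(\<integral>\<^sup>+x. g x * indicator A x \<partial>N) \<le> (\<integral>\<^sup>+x. g x \<partial>N)"
    by (intro nn_integral_mono) (simp add: indicator_def)
  then have "(\<integral>\<^sup>+x. g x * indicator A x \<partial>N) < \<infinity>"
    using fin by (rule le_less_trans)
  then have "(\<integral>\<^sup>+x. g x * indicator A x \<partial>N) \<noteq> \<infinity>"
    by simp
  moreover have "AE x in N. g x * indicator A x \<le> f x * indicator A x"
    by (auto simp: A_def indicator_def)
  ultimately have "(\<integral>\<^sup>+x. g x * indicator A x \<partial>N) < (\<integral>\<^sup>+x. f x * indicator A x \<partial>N)"
    if "\<not> (AE x in N. f x * indicator A x \<le> g x * indicator A x)"
    using that by (intro nn_integral_less) auto
  then have "AE x in N. f x * indicator A x \<le> g x * indicator A x"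
    using le[OF A] by (auto simp: not_le[symmetric])
  then show ?thesis
    using AE_space
  proof eventually_elim
    case (elim x)
    then show ?case by (cases "x \<in> A") (auto simp: A_def)
  qed
qed

context measured_groupoid
begin

text \<open>The setting for the Radon--Nikodym theorem on the source of \<open>K\<close>; the last fact identifies
  the integral of \<open>rn_ratio\<close> over \<open>A\<close> with the measure of the image of \<open>A\<close>.\<close>

lemma rn_ratio_facts:
  assumes K: "admissible G l M K"
  defines "N \<equiv> restrict_space M (src G ` K)"
  shows finite_measure_src: "finite_measure N"
    and finite_measure_pullback: "finite_measure (pullback_measure G M K)"
    and absolutely_continuous_pullback: "absolutely_continuous N (pullback_measure G M K)"
    and sets_pullback: "sets (pullback_measure G M K) = sets N"
    and nn_integral_rn_ratio: "\<And>A. A \<in> sets M \<Longrightarrow> A \<subseteq> src G ` K \<Longrightarrow>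
      (\<integral>\<^sup>+x. rn_ratio G M K x * indicator A x \<partial>N) = emeasure M (rng_act G K A)"
proof -
  let ?P = "pullback_measure G M K"
  have S: "src G ` K \<in> sets M" and bis: "bisection G K"
    using K by (auto simp: admissible_iff)
  have sp: "space N = src G ` K"
    using sets.sets_into_space[OF S] by (auto simp: N_def space_restrict_space)
  have st: "A \<in> sets N \<longleftrightarrow> A \<subseteq> src G ` K \<and> A \<in> sets M" for A
    using S by (auto simp: N_def sets_restrict_space_iff)
  have emN: "emeasure N A = emeasure M A" if "A \<in> sets M" "A \<subseteq> src G ` K" for A
    using that S by (simp add: N_def emeasure_restrict_space)
  have emP: "emeasure ?P A = emeasure M (rng_act G K A)" if "A \<in> sets M" "A \<subseteq> src G ` K" for A
    using that K by (simp add: emeasure_pullback_measure tau_image bis)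
  show fN: "finite_measure N"
    using S by (intro finite_measureI) (simp add: sp emN)
  show sP: "sets ?P = sets N"
    by (simp add: pullback_measure_def N_def)
  then have "space ?P = src G ` K"
    using sets_eq_imp_space_eq sp by metis
  then show fP: "finite_measure ?P"
    using S by (intro finite_measureI) (simp add: emP)
  show ac: "absolutely_continuous N ?P"
    unfolding absolutely_continuous_def
  proof
    fix A assume A: "A \<in> null_sets N"
    then have "A \<in> sets M" "A \<subseteq> src G ` K"
      by (auto simp: null_sets_def st)
    with A have "A \<in> null_sets M"
      by (auto simp: null_sets_def emN)
    then have "rng_act G K A \<in> null_sets M"
      using K by (auto simp: admissible_iff)
    then show "A \<in> null_sets ?P"
      using \<open>A \<in> sets M\<close> \<open>A \<subseteq> src G ` K\<close> by (auto simp: null_sets_def sP st emP)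
  qed
  interpret N: finite_measure N by (fact fN)
  fix A assume A: "A \<in> sets M" "A \<subseteq> src G ` K"
  have "density N (rn_ratio G M K) = ?P"
    unfolding rn_ratio_def N_def[symmetric] by (rule N.density_RN_deriv[OF ac sP])
  then have "emeasure (density N (rn_ratio G M K)) A = emeasure M (rng_act G K A)"
    using emP A by simp
  moreover have "rn_ratio G M K \<in> borel_measurable N"
    by (simp add: rn_ratio_def N_def)
  ultimately show "(\<integral>\<^sup>+x. rn_ratio G M K x * indicator A x \<partial>N) = emeasure M (rng_act G K A)"
    using A by (simp add: emeasure_density st)
qed

lemma AE_rn_ratio_if_ratio_bounded:
  assumes K: "admissible G l M K" and b: "ratio_bounded G M \<theta> K" and \<theta>: "\<theta> \<ge> 1"
  shows "AE x in M. x \<in> src G ` K \<longrightarrow>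
    ennreal (1 / \<theta>) \<le> rn_ratio G M K x \<and> rn_ratio G M K x \<le> ennreal \<theta>"
proof -
  define N where "N = restrict_space M (src G ` K)"
  have S: "src G ` K \<in> sets M"
    using K by (auto simp: admissible_iff)
  have sp: "space N = src G ` K"
    using sets.sets_into_space[OF S] by (auto simp: N_def space_restrict_space)
  have st: "A \<in> sets N \<longleftrightarrow> A \<subseteq> src G ` K \<and> A \<in> sets M" for A
    using S by (auto simp: N_def sets_restrict_space_iff)
  interpret N: finite_measure N
    unfolding N_def by (rule finite_measure_src[OF K])
  have meas[measurable]: "rn_ratio G M K \<in> borel_measurable N"
    by (simp add: rn_ratio_def N_def)
  have const: "(\<integral>\<^sup>+x. ennreal c * indicator A x \<partial>N) = ennreal (c * measure M A)"
    if "A \<in> sets N" "c \<ge> 0" for A c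
    using that S
    by (simp add: nn_integral_cmult_indicator N_def st[unfolded N_def] emeasure_restrict_space
        emeasure_eq_measure ennreal_mult)
  have ratio: "(\<integral>\<^sup>+x. rn_ratio G M K x * indicator A x \<partial>N) = ennreal (measure M (rng_act G K A))"
    if "A \<in> sets N" for A
    using nn_integral_rn_ratio[OF K, of A] that by (simp add: N_def st[unfolded N_def] emeasure_eq_measure)
  have "(\<integral>\<^sup>+x. rn_ratio G M K x \<partial>N) = (\<integral>\<^sup>+x. rn_ratio G M K x * indicator (src G ` K) x \<partial>N)"
    by (intro nn_integral_cong) (simp add: sp)
  also have "\<dots> < \<infinity>"
    by (subst ratio) (auto simp: st S)
  finally have fin: "(\<integral>\<^sup>+x. rn_ratio G M K x \<partial>N) < \<infinity>" .
  have "AE x in N. rn_ratio G M K x \<le> ennreal \<theta>"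
  proof (rule AE_le_if_set_nn_integral_le)
    show "(\<integral>\<^sup>+x. ennreal \<theta> \<partial>N) < \<infinity>"
      by (simp add: ennreal_mult_less_top N.emeasure_eq_measure)
    fix A assume A: "A \<in> sets N"
    then have "measure M (rng_act G K A) \<le> \<theta> * measure M A"
      using b by (auto simp: ratio_bounded_def st)
    then show "(\<integral>\<^sup>+x. rn_ratio G M K x * indicator A x \<partial>N) \<le> (\<integral>\<^sup>+x. ennreal \<theta> * indicator A x \<partial>N)"
      using A \<theta> by (simp add: ratio const ennreal_leI)
  qed auto
  moreover have "AE x in N. ennreal (1 / \<theta>) \<le> rn_ratio G M K x"
  proof (rule AE_le_if_set_nn_integral_le)
    fix A assume A: "A \<in> sets N"
    then have "measure M A \<le> \<theta> * measure M (rng_act G K A)"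
      using b by (auto simp: ratio_bounded_def st)
    then have "1 / \<theta> * measure M A \<le> measure M (rng_act G K A)"
      using \<theta> by (simp add: field_simps)
    then show "(\<integral>\<^sup>+x. ennreal (1 / \<theta>) * indicator A x \<partial>N) \<le> (\<integral>\<^sup>+x. rn_ratio G M K x * indicator A x \<partial>N)"
      unfolding ratio[OF A] using A \<theta> by (subst const) (auto intro: ennreal_leI)
  qed (use fin in auto)
  ultimately have "AE x in N. ennreal (1 / \<theta>) \<le> rn_ratio G M K x \<and> rn_ratio G M K x \<le> ennreal \<theta>"
    by eventually_elim simp
  then show ?thesis
    unfolding N_def using S by (subst (asm) AE_restrict_space_iff) auto
qed

lemma ratio_bounded_ginv:
  assumes K: "admissible G l M K" and b: "ratio_bounded G M \<theta> K"
  shows "ratio_bounded G M \<theta> (ginv G ` K)"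
  unfolding ratio_bounded_def
proof (intro ballI impI)
  fix A assume A: "A \<in> sets M" "A \<subseteq> src G ` ginv G ` K"
  have arr: "K \<subseteq> arrows G" and inj: "inj_on (src G) K"
    using K by (auto simp: admissible_iff bisection_def)
  let ?B = "rng_act G (ginv G ` K) A"
  have AR: "A \<subseteq> rng G ` K" using A arr by (simp add: src_image_ginv)
  have B: "?B = src G ` {g \<in> K. rng G g \<in> A}"
    by (rule rng_act_ginv[OF arr])
  have "rng_act G K ?B = A"
    using AR inj unfolding B by (auto simp: rng_act_def inj_on_def)
  moreover have "?B \<in> sets M" "?B \<subseteq> src G ` K"
    using K A B by (auto simp: admissible_iff)
  ultimately show "measure M A \<le> \<theta> * measure M ?B \<and> measure M ?B \<le> \<theta> * measure M A"
    using b by (auto simp: ratio_bounded_def)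
qed

lemma ratio_bounded_units: "\<theta> \<ge> 1 \<Longrightarrow> ratio_bounded G M \<theta> (units G)"
proof -
  assume "\<theta> \<ge> 1"
  moreover have "rng_act G (units G) A = A" if "A \<subseteq> src G ` units G" for A
    using that src_unit rng_unit by (force simp: rng_act_def)
  ultimately show ?thesis
    by (auto simp: ratio_bounded_def mult_le_cancel_right1)
qed

section \<open>Truncation to bounded ratios\<close>

text \<open>The sets where the derivative \<open>d\<close> leaves \<open>[1/(n+1), n+1]\<close> decrease to the set where it
  vanishes, which is null for the pulled back measure. Hence their images eventually have measure
  less than \<open>\<eta>\<close>, and the restriction of \<open>K\<close> to the complement of one of them does the job.\<close>

lemma truncate_bisection:
  assumes K: "admissible G l M K" and \<eta>: "\<eta> > 0"
  obtains K' \<theta> where "K' \<subseteq> K" "admissible G l M K'" "\<theta> \<ge> 1" "ratio_bounded G M \<theta> K'"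
    "\<And>A. A \<in> sets M \<Longrightarrow> measure M (rng_act G K A - rng_act G K' A) \<le> \<eta>"
proof -
  define N where "N = restrict_space M (src G ` K)"
  define P where "P = pullback_measure G M K"
  have S: "src G ` K \<in> sets M" and bis: "bisection G K"
    using K by (auto simp: admissible_iff)
  have sp: "space N = src G ` K"
    using sets.sets_into_space[OF S] by (auto simp: N_def space_restrict_space)
  have st: "A \<in> sets N \<longleftrightarrow> A \<subseteq> src G ` K \<and> A \<in> sets M" for A
    using S by (auto simp: N_def sets_restrict_space_iff)
  interpret N: finite_measure N
    unfolding N_def by (rule finite_measure_src[OF K])
  interpret P: finite_measure P
    unfolding P_def by (rule finite_measure_pullback[OF K])
  have ac: "absolutely_continuous N P" and sP: "sets P = sets N"
    unfolding N_def P_def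
    by (rule absolutely_continuous_pullback[OF K], rule sets_pullback[OF K])
  have spP: "space P = src G ` K"
    using sets_eq_imp_space_eq[OF sP] sp by simp
  have measure_P: "measure P A = measure M (rng_act G K A)" if "A \<in> sets N" for A
    using that K
    by (simp add: measure_def P_def st emeasure_pullback_measure tau_image bis)
  obtain d where d[measurable]: "d \<in> borel_measurable N"
    and RN: "AE x in N. RN_deriv N P x = ennreal (d x)"
    and pos: "AE x in P. 0 < d x" and nonneg: "\<And>x. 0 \<le> d x"
    using N.real_RN_deriv[OF P.finite_measure_axioms ac sP] by metis
  define D where "D n = {x \<in> space N. 1 / (real n + 1) \<le> d x \<and> d x \<le> real n + 1}" for n :: nat
  define E where "E n = space N - D n" for n
  have D[measurable]: "D n \<in> sets N" for n
    unfolding D_def by measurable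
  have E[measurable]: "E n \<in> sets N" for n
    unfolding E_def by measurable
  have "decseq E"
  proof (rule decseq_SucI)
    fix n
    have "1 / (real (Suc n) + 1) \<le> 1 / (real n + 1)"
      by (intro divide_left_mono) auto
    then show "E (Suc n) \<le> E n"
      by (auto simp: E_def D_def)
  qed
  have "(\<lambda>n. measure P (E n)) \<longlonglongrightarrow> measure P (\<Inter>n. E n)"
    using \<open>decseq E\<close> E by (intro P.finite_Lim_measure_decseq) (auto simp: sP)
  moreover have "measure P (\<Inter>n. E n) = 0"
  proof -
    have "\<not> 0 < d x" if "x \<in> (\<Inter>n. E n)" for x
    proof
      assume "0 < d x"
      obtain n :: nat where n: "max (d x) (1 / d x) \<le> real n"
        using real_arch_simple by blast
      then have "d x \<le> real n + 1" and "1 / d x \<le> real n + 1"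
        by auto
      then have "1 / (real n + 1) \<le> d x"
        using \<open>0 < d x\<close> by (simp add: field_simps)
      then show False
        using that \<open>d x \<le> real n + 1\<close> by (auto simp: E_def D_def)
    qed
    note not_pos = this
    from pos have "AE x in P. x \<notin> (\<Inter>n. E n)"
      by eventually_elim (use not_pos in blast)
    moreover have "(\<Inter>n. E n) \<in> sets P"
      using E by (simp add: sP)
    ultimately have "(\<Inter>n. E n) \<in> null_sets P"
      by (simp add: AE_iff_null_sets)
    then show ?thesis
      by (simp add: measure_eq_0_null_sets)
  qed
  ultimately have "eventually (\<lambda>n. measure P (E n) < \<eta>) sequentially"
    using \<eta> by (simp add: order_tendsto_iff)
  then obtain n where n: "measure P (E n) < \<eta>"
    by (auto simp: eventually_sequentially)
  define K' where "K' = {g \<in> K. src G g \<in> D n}"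
  define \<theta> where "\<theta> = real n + 1"
  have \<theta>: "\<theta> \<ge> 1" by (simp add: \<theta>_def)
  have const: "(\<integral>\<^sup>+x. ennreal c * indicator A x \<partial>N) = ennreal (c * measure M A)"
    if "A \<in> sets N" "c \<ge> 0" for A c
    using that S
    by (simp add: nn_integral_cmult_indicator N_def st[unfolded N_def] emeasure_restrict_space
        emeasure_eq_measure ennreal_mult)
  have int: "(\<integral>\<^sup>+x. ennreal (d x) * indicator A x \<partial>N) = ennreal (measure M (rng_act G K A))"
    if "A \<in> sets N" for A
  proof -
    have "(\<integral>\<^sup>+x. ennreal (d x) * indicator A x \<partial>N) = (\<integral>\<^sup>+x. rn_ratio G M K x * indicator A x \<partial>N)"
      using RN unfolding rn_ratio_def N_def[symmetric] P_def[symmetric]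
      by (intro nn_integral_cong_AE) auto
    also have "\<dots> = emeasure M (rng_act G K A)"
      using nn_integral_rn_ratio[OF K, of A] that by (simp add: N_def st[unfolded N_def])
    finally show ?thesis
      by (simp add: emeasure_eq_measure)
  qed
  have srcK': "src G ` K' \<subseteq> D n"
    by (auto simp: K'_def)
  have "ratio_bounded G M \<theta> K'"
    unfolding ratio_bounded_def
  proof (intro ballI impI)
    fix A assume A: "A \<in> sets M" "A \<subseteq> src G ` K'"
    then have AD: "A \<subseteq> D n" and AN: "A \<in> sets N"
      using srcK' by (auto simp: st K'_def)
    then have d_bounds: "1 / \<theta> \<le> d x" "d x \<le> \<theta>" if "x \<in> A" for x
      using that by (auto simp: D_def \<theta>_def)
    have act: "rng_act G K' A = rng_act G K A"
      using AD by (auto simp: rng_act_def K'_def)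
    have "ennreal (measure M (rng_act G K A)) \<le> ennreal (\<theta> * measure M A)"
      unfolding int[OF AN, symmetric] using \<theta> d_bounds
      by (subst const[OF AN, symmetric], simp, intro nn_integral_mono)
         (auto simp: indicator_def intro!: ennreal_leI)
    then have "measure M (rng_act G K A) \<le> \<theta> * measure M A"
      using \<theta> by (subst (asm) ennreal_le_iff) auto
    moreover have "ennreal (1 / \<theta> * measure M A) \<le> ennreal (measure M (rng_act G K A))"
      unfolding int[OF AN, symmetric] using \<theta> d_bounds
      by (subst const[OF AN, symmetric], simp, intro nn_integral_mono)
         (auto simp: indicator_def intro!: ennreal_leI)
    then have "1 / \<theta> * measure M A \<le> measure M (rng_act G K A)"
      by (subst (asm) ennreal_le_iff) auto
    then have "measure M A \<le> \<theta> * measure M (rng_act G K A)"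
      using \<theta> by (simp add: field_simps)
    ultimately show "measure M A \<le> \<theta> * measure M (rng_act G K' A) \<and>
        measure M (rng_act G K' A) \<le> \<theta> * measure M A"
      by (simp add: act)
  qed
  moreover have "admissible G l M K'"
    unfolding K'_def using D[of n] by (intro admissible_restrict K) (simp add: st)
  moreover have "measure M (rng_act G K A - rng_act G K' A) \<le> \<eta>" if "A \<in> sets M" for A
  proof -
    have "rng_act G K A - rng_act G K' A \<subseteq> rng_act G K (E n)"
      by (auto simp: rng_act_def K'_def E_def sp)
    moreover have "rng_act G K (E n) \<in> sets M"
      using K E[of n] by (auto simp: admissible_iff st)
    ultimately have "measure M (rng_act G K A - rng_act G K' A) \<le> measure M (rng_act G K (E n))"
      by (rule finite_measure_mono)
    also have "\<dots> < \<eta>"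
      using n measure_P[OF E] by simp
    finally show ?thesis by simp
  qed
  ultimately show thesis
    using that[of K' \<theta>] \<theta> by (auto simp: K'_def)
qed

lemma sets_rng_act_Union:
  assumes "finite \<B>" "\<And>B. B \<in> \<B> \<Longrightarrow> admissible G l M B" "A \<in> sets M"
  shows "rng_act G (\<Union>\<B>) A \<in> sets M"
  unfolding rng_act_Union_left using assms
  by (intro sets.finite_UN) (auto simp: admissible_iff)

text \<open>The bound \<open>\<eta>\<close> is split among the bisections by induction on the family, and the largest of
  their ratio bounds serves for all.\<close>

lemma truncate_family:
  assumes "finite \<B>" "\<And>B. B \<in> \<B> \<Longrightarrow> admissible G l M B" "\<eta> > 0"
  obtains \<C> \<theta> where "finite \<C>" "\<Union>\<C> \<subseteq> \<Union>\<B>" "\<And>C. C \<in> \<C> \<Longrightarrow> admissible G l M C"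
    "\<theta> \<ge> 1" "\<And>C. C \<in> \<C> \<Longrightarrow> ratio_bounded G M \<theta> C"
    "\<And>A. A \<in> sets M \<Longrightarrow> measure M (rng_act G (\<Union>\<B>) A - rng_act G (\<Union>\<C>) A) \<le> \<eta>"
proof -
  have "\<exists>\<C> \<theta>. finite \<C> \<and> \<Union>\<C> \<subseteq> \<Union>\<B> \<and> (\<forall>C\<in>\<C>. admissible G l M C) \<and> \<theta> \<ge> 1 \<and>
      (\<forall>C\<in>\<C>. ratio_bounded G M \<theta> C) \<and>
      (\<forall>A\<in>sets M. measure M (rng_act G (\<Union>\<B>) A - rng_act G (\<Union>\<C>) A) \<le> \<eta>)"
    using assms
  proof (induction arbitrary: \<eta> rule: finite_induct)
    case empty
    then show ?case
      by (intro exI[of _ "{}"] exI[of _ 1]) (auto simp: rng_act_def)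
  next
    case (insert B \<B>)
    obtain \<C> \<theta> where \<C>: "finite \<C>" "\<Union>\<C> \<subseteq> \<Union>\<B>" "\<And>C. C \<in> \<C> \<Longrightarrow> admissible G l M C"
      and \<theta>: "\<theta> \<ge> 1" "\<And>C. C \<in> \<C> \<Longrightarrow> ratio_bounded G M \<theta> C"
      and le: "\<And>A. A \<in> sets M \<Longrightarrow> measure M (rng_act G (\<Union>\<B>) A - rng_act G (\<Union>\<C>) A) \<le> \<eta> / 2"
      using insert.IH[of "\<eta> / 2"] insert.prems by auto
    obtain B' \<theta>' where B': "B' \<subseteq> B" "admissible G l M B'" "\<theta>' \<ge> 1" "ratio_bounded G M \<theta>' B'"
      and le': "\<And>A. A \<in> sets M \<Longrightarrow> measure M (rng_act G B A - rng_act G B' A) \<le> \<eta> / 2"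
      using truncate_bisection[of B "\<eta> / 2"] insert.prems by auto
    have "measure M (rng_act G (\<Union>(insert B \<B>)) A - rng_act G (\<Union>(insert B' \<C>)) A) \<le> \<eta>"
      if A: "A \<in> sets M" for A
    proof -
      let ?X = "rng_act G B A - rng_act G B' A" and ?Y = "rng_act G (\<Union>\<B>) A - rng_act G (\<Union>\<C>) A"
      have meas: "?X \<in> sets M" "?Y \<in> sets M"
        using A \<C> B' insert.hyps insert.prems
        by (auto simp: admissible_iff intro!: sets.Diff sets_rng_act_Union)
      have "rng_act G (\<Union>(insert B \<B>)) A - rng_act G (\<Union>(insert B' \<C>)) A \<subseteq> ?X \<union> ?Y"
        by (auto simp: rng_act_def)
      then have "measure M (rng_act G (\<Union>(insert B \<B>)) A - rng_act G (\<Union>(insert B' \<C>)) A)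
          \<le> measure M (?X \<union> ?Y)"
        using meas by (intro finite_measure_mono) auto
      also have "\<dots> \<le> measure M ?X + measure M ?Y"
        by (rule measure_Un_le) (use meas in auto)
      finally show ?thesis
        using le[OF A] le'[OF A] by simp
    qed
    moreover have "ratio_bounded G M (max \<theta> \<theta>') C" if "C \<in> insert B' \<C>" for C
      using that \<theta>(2) B'(4)
      by (elim insertE) (auto intro: ratio_bounded_mono[OF _ max.cobounded1]
          ratio_bounded_mono[OF _ max.cobounded2])
    ultimately show ?case
      using \<C> \<theta>(1) B'
      by (intro exI[of _ "insert B' \<C>"] exI[of _ "max \<theta> \<theta>'"]) auto
  qed
  then show thesis using that by blast
qed

section \<open>Unital symmetric families\<close>

text \<open>Inversion is an involution of the set of bisections \<open>\<B>\<close>; transported along an enumeration of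
  \<open>\<B>\<close> it becomes the permutation \<open>\<sigma>\<close> that a symmetric decomposition asks for.\<close>

lemma N_decomposable_family:
  assumes fin: "finite \<B>" and adm: "\<And>B. B \<in> \<B> \<Longrightarrow> admissible G l M B"
    and unit: "units G \<in> \<B>" and sym: "\<And>B. B \<in> \<B> \<Longrightarrow> ginv G ` B \<in> \<B>"
  obtains Ks where "N_decomposable G l M (card \<B>) (\<Union>\<B>)"
    "unital_symmetric_decomposition G l M (card \<B>) Ks (\<Union>\<B>)"
    "\<And>i. i \<in> {1..card \<B>} \<Longrightarrow> Ks i \<in> \<B>"
proof -
  obtain Ks where Ks: "bij_betw Ks {1..card \<B>} \<B>"
    using ex_bij_betw_nat_finite_1[OF fin] by blast
  then have img: "Ks ` {1..card \<B>} = \<B>"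
    by (simp add: bij_betw_def)
  have arr: "B \<subseteq> arrows G" if "B \<in> \<B>" for B
    using adm[OF that] by (simp add: admissible_iff bisection_def)
  have inv: "ginv G ` ginv G ` B = B" if "B \<in> \<B>" for B
    using arr[OF that] by (rule ginv_image_ginv_image)
  have bij_ginv: "bij_betw ((`) (ginv G)) \<B> \<B>"
    using sym inv by (intro bij_betw_byWitness[of _ "(`) (ginv G)"]) auto
  define \<sigma> where "\<sigma> = inv_into {1..card \<B>} Ks \<circ> ((`) (ginv G) \<circ> Ks)"
  have "bij_betw \<sigma> {1..card \<B>} {1..card \<B>}"
    unfolding \<sigma>_def
    by (rule bij_betw_trans[OF bij_betw_trans[OF Ks bij_ginv] bij_betw_inv_into[OF Ks]])
  moreover have "ginv G ` Ks i = Ks (\<sigma> i)" if "i \<in> {1..card \<B>}" for i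
  proof -
    have "ginv G ` Ks i \<in> \<B>" using sym img that by blast
    then show ?thesis
      unfolding \<sigma>_def using bij_betw_inv_into_right[OF Ks] by simp
  qed
  moreover have "\<exists>i\<in>{1..card \<B>}. Ks i = units G"
    using unit img by (metis imageE)
  moreover have "decomposition G l M (card \<B>) Ks (\<Union>\<B>)"
    unfolding decomposition_def using img adm by auto
  ultimately have usd: "unital_symmetric_decomposition G l M (card \<B>) Ks (\<Union>\<B>)"
    unfolding unital_symmetric_decomposition_def by blast
  have "unital_subset G (\<Union>\<B>)"
    unfolding unital_subset_def using arr unit by blast
  moreover have "symmetric_subset G (\<Union>\<B>)"
  proof -
    have "ginv G ` \<Union>\<B> = \<Union>((`) (ginv G) ` \<B>)"
      by (simp add: image_Union)
    also have "(`) (ginv G) ` \<B> = \<B>"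
      using bij_ginv by (simp add: bij_betw_def)
    finally show ?thesis
      unfolding symmetric_subset_def using arr by auto
  qed
  moreover have "decomposable G l M (\<Union>\<B>)"
    unfolding decomposable_def using fin adm by blast
  ultimately have "N_decomposable G l M (card \<B>) (\<Union>\<B>)"
    unfolding N_decomposable_def using usd by blast
  then show thesis
    using that usd img by blast
qed

lemma finite_set_length_Union:
  assumes "finite \<B>" "\<And>B. B \<in> \<B> \<Longrightarrow> admissible G l M B"
  obtains L where "L > 0" "set_length l (\<Union>\<B>) \<le> ennreal L"
proof -
  have "set_length l (\<Union>\<B>) < \<infinity>"
    using assms
  proof (induction rule: finite_induct)
    case empty
    then show ?case by (simp add: set_length_def bot_ennreal)
  next
    case (insert B \<B>)
    have "set_length l (\<Union>(insert B \<B>)) = sup (set_length l B) (set_length l (\<Union>\<B>))"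
      by (simp add: set_length_def SUP_union)
    then show ?case
      using insert by (auto simp: admissible_iff sup_max)
  qed
  then have "set_length l (\<Union>\<B>) \<le> ennreal (enn2real (set_length l (\<Union>\<B>)) + 1)"
    by (subst ennreal_plus) (auto simp: ennreal_enn2real less_top[symmetric])
  then show thesis
    by (intro that[of "enn2real (set_length l (\<Union>\<B>)) + 1"]) (auto intro: add_nonneg_pos)
qed

section \<open>Uniform absolute continuity\<close>

lemma measure_rng_act_ratio_bounded_le:
  assumes "finite \<C>" and adm: "\<And>C. C \<in> \<C> \<Longrightarrow> admissible G l M C"
    and b: "\<And>C. C \<in> \<C> \<Longrightarrow> ratio_bounded G M \<theta> C" and "\<theta> \<ge> 0" and A: "A \<in> sets M"
  shows "measure M (rng_act G (\<Union>\<C>) A) \<le> card \<C> * (\<theta> * measure M A)"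
proof -
  have le: "measure M (rng_act G C A) \<le> \<theta> * measure M A" if "C \<in> \<C>" for C
  proof -
    have S: "src G ` C \<in> sets M" using adm[OF that] by (simp add: admissible_iff)
    have "measure M (rng_act G C A) = measure M (rng_act G C (A \<inter> src G ` C))"
      by (simp add: rng_act_Int_src)
    also have "\<dots> \<le> \<theta> * measure M (A \<inter> src G ` C)"
      using b[OF that] A S by (simp add: ratio_bounded_def)
    also have "\<dots> \<le> \<theta> * measure M A"
      using A \<open>\<theta> \<ge> 0\<close> by (intro mult_left_mono finite_measure_mono) auto
    finally show ?thesis .
  qed
  have "measure M (rng_act G (\<Union>\<C>) A) \<le> (\<Sum>C\<in>\<C>. measure M (rng_act G C A))"
    unfolding rng_act_Union_left
    by (rule finite_measure_subadditive_finite) (use assms in \<open>auto simp: admissible_iff\<close>)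
  also have "\<dots> \<le> (\<Sum>C\<in>\<C>. \<theta> * measure M A)"
    by (rule sum_mono) (rule le)
  finally show ?thesis by simp
qed

text \<open>After a truncation that loses at most \<open>e / 2\<close>, the image of \<open>A\<close> has measure at most a
  constant times that of \<open>A\<close>.\<close>

lemma rng_act_uniformly_absolutely_continuous:
  assumes fin: "finite \<B>" and adm: "\<And>B. B \<in> \<B> \<Longrightarrow> admissible G l M B" and e: "e > 0"
  obtains \<delta> where "\<delta> > 0"
    "\<And>A. A \<in> sets M \<Longrightarrow> measure M A < \<delta> \<Longrightarrow> measure M (rng_act G (\<Union>\<B>) A) < e"
proof -
  obtain \<C> \<theta> where \<C>: "finite \<C>" "\<Union>\<C> \<subseteq> \<Union>\<B>" "\<And>C. C \<in> \<C> \<Longrightarrow> admissible G l M C"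
    and \<theta>: "\<theta> \<ge> 1" "\<And>C. C \<in> \<C> \<Longrightarrow> ratio_bounded G M \<theta> C"
    and tr: "\<And>A. A \<in> sets M \<Longrightarrow> measure M (rng_act G (\<Union>\<B>) A - rng_act G (\<Union>\<C>) A) \<le> e / 2"
    using truncate_family[OF fin adm, of "e / 2"] e by (metis half_gt_zero)
  define q where "q = card \<C> * \<theta> + 1"
  have q: "q > 0" using \<theta> by (simp add: q_def add_nonneg_pos)
  show thesis
  proof
    show "e / (2 * q) > 0" using e q by simp
    fix A assume A: "A \<in> sets M" and small: "measure M A < e / (2 * q)"
    have meas: "rng_act G (\<Union>\<B>) A \<in> sets M" "rng_act G (\<Union>\<C>) A \<in> sets M"
      using A fin adm \<C> by (auto intro: sets_rng_act_Union)
    have "measure M (rng_act G (\<Union>\<B>) A) \<le>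
        measure M ((rng_act G (\<Union>\<B>) A - rng_act G (\<Union>\<C>) A) \<union> rng_act G (\<Union>\<C>) A)"
      using meas by (intro finite_measure_mono) auto
    also have "\<dots> \<le> measure M (rng_act G (\<Union>\<B>) A - rng_act G (\<Union>\<C>) A) + measure M (rng_act G (\<Union>\<C>) A)"
      using meas by (intro measure_Un_le) auto
    also have "\<dots> \<le> e / 2 + card \<C> * (\<theta> * measure M A)"
      using tr[OF A] \<C> \<theta> A measure_rng_act_ratio_bounded_le[of \<C> \<theta> A] by simp
    also have "card \<C> * (\<theta> * measure M A) \<le> q * measure M A"
      by (simp add: q_def distrib_right)
    also have "q * measure M A < e / 2"
      using small q by (simp add: field_simps)
    finally show "measure M (rng_act G (\<Union>\<B>) A) < e" by simp
  qed
qed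

section \<open>From domains to asymptotic expansion\<close>

lemma measure_units: "measure M (units G) = 1"
  using prob_space by (simp add: space_units)

text \<open>In a null set \<open>Y\<close> the empty set would meet the size condition of asymptotic expansion without
  expanding, whereas expansion is vacuous there; this is why \<open>Y\<close> must have positive measure.\<close>

lemma domain_of_expansion_imp_asymptotic:
  assumes "domain_of_expansion G l M C N L \<theta> Y" "C > 0" "N > 0" "L > 0"
    and Y: "measure M Y > 0"
  shows "domain_of_asymptotic_expansion G l M Y"
proof -
  obtain K where K: "N_decomposable G l M N K" "set_length l K \<le> ennreal L"
    and exp: "\<And>A. A \<in> sets M \<Longrightarrow> A \<subseteq> Y \<Longrightarrow> 0 < measure M A \<Longrightarrow> measure M A \<le> 1/2 * measure M Y \<Longrightarrow>
      measure M ((rng_act G K A - A) \<inter> Y) > C * measure M A"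
    and meas: "Y \<in> sets M"
    using assms(1) unfolding domain_of_expansion_def by auto
  have pos: "0 < measure M A" if "0 < \<alpha>" "\<alpha> * measure M Y \<le> measure M A" for \<alpha> A
    using that Y by (meson less_le_trans mult_pos_pos)
  show ?thesis
    unfolding domain_of_asymptotic_expansion_def
    using assms(2-4) K exp pos meas by blast
qed

text \<open>In the case distinction on how much of \<open>Y\<close> is filled by \<open>A\<close>, the set \<open>E\<close> of the second case
  consists of the points of \<open>A\<close> reached from \<open>B = Y - A\<close>. By symmetry \<open>E\<close> is contained in the image
  of \<open>K E \<inter> B\<close>, which lies in the boundary of \<open>A\<close>; since \<open>E\<close> is large, \<open>K E \<inter> B\<close> cannot be small.\<close>

lemma asymptotically_expanding_if_domains:
  assumes dom: "\<And>\<epsilon>. \<epsilon> > 0 \<Longrightarrow> \<exists>Y. domain_of_asymptotic_expansion G l M Y \<and> measure M Y > 1 - \<epsilon>"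
  shows "asymptotically_expanding_in_measure G l M"
  unfolding asymptotically_expanding_in_measure_def domain_of_asymptotic_expansion_def
proof (intro conjI allI impI)
  show "units G \<in> sets M"
    by (simp flip: space_units)
  fix \<alpha> :: real
  assume \<alpha>: "0 < \<alpha> \<and> \<alpha> \<le> 1 / 2"
  obtain Y where Ydom: "domain_of_asymptotic_expansion G l M Y" and Ybig: "measure M Y > 1 - \<alpha> / 4"
    using dom[of "\<alpha> / 4"] \<alpha> by auto
  have Y: "Y \<in> sets M"
    using Ydom by (simp add: domain_of_asymptotic_expansion_def)
  obtain C N L K where C: "C > 0" and N: "(N::nat) > 0" and L: "L > 0"
    and K: "N_decomposable G l M N K" "set_length l K \<le> ennreal L"
    and exp: "\<And>A. A \<in> sets M \<Longrightarrow> A \<subseteq> Y \<Longrightarrow> \<alpha> / 4 * measure M Y \<le> measure M A \<Longrightarrow>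
      measure M A \<le> 1/2 * measure M Y \<Longrightarrow> measure M ((rng_act G K A - A) \<inter> Y) > C * measure M A"
  proof -
    have "0 < \<alpha> / 4 \<and> \<alpha> / 4 \<le> 1 / 2" using \<alpha> by simp
    then show thesis
      using Ydom that unfolding domain_of_asymptotic_expansion_def by meson
  qed
  obtain \<B> where \<B>: "finite \<B>" "\<And>B. B \<in> \<B> \<Longrightarrow> admissible G l M B" "K = \<Union>\<B>"
    using K(1) by (auto simp: N_decomposable_def decomposable_def)
  have arr: "K \<subseteq> arrows G" and sym: "ginv G ` K = K"
    using K(1) by (auto simp: N_decomposable_def symmetric_subset_def)
  have act_meas: "rng_act G K A \<in> sets M" if "A \<in> sets M" for A
    using sets_rng_act_Union[OF \<B>(1,2) that] by (simp add: \<B>(3))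
  have act_units: "rng_act G K A \<subseteq> units G" for A
    using arr rng_in_units by (auto simp: rng_act_def)
  have "C * (\<alpha> / 4) > 0" using C \<alpha> by simp
  then obtain \<delta> where \<delta>: "\<delta> > 0"
    "\<And>A. A \<in> sets M \<Longrightarrow> measure M A < \<delta> \<Longrightarrow> measure M (rng_act G K A) < C * (\<alpha> / 4)"
    using rng_act_uniformly_absolutely_continuous[OF \<B>(1,2)] \<B>(3) by metis
  \<comment> \<open>The two cases below bound the boundary of \<open>A\<close> from below by \<open>C * (\<alpha> / 4)\<close> and by \<open>\<delta>\<close>;
    as \<open>\<mu> A \<le> 1 / 2\<close>, either bound exceeds itself times \<open>\<mu> A\<close>.\<close>
  define c where "c = min (C * (\<alpha> / 4)) \<delta>"
  have c: "c > 0" using C \<alpha> \<delta> by (simp add: c_def)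
  have \<alpha>Y: "\<alpha> / 4 * measure M Y \<le> \<alpha> / 4"
    using \<alpha> prob_le_1[of Y] by (intro mult_left_le) auto
  have main: "measure M ((rng_act G K A - A) \<inter> units G) > c * measure M A"
    if A: "A \<in> sets M" and lo: "\<alpha> \<le> measure M A" and hi: "measure M A \<le> 1 / 2" for A
  proof -
    have bd_meas: "rng_act G K A - A \<in> sets M"
      using A act_meas by auto
    have bd_units: "(rng_act G K A - A) \<inter> units G = rng_act G K A - A"
      using act_units by auto
    have "c \<le> measure M (rng_act G K A - A)"
    proof (cases "measure M (A \<inter> Y) \<le> 1/2 * measure M Y")
      case True
      have "measure M A \<le> measure M ((A \<inter> Y) \<union> (space M - Y))"
        using A Y sets.sets_into_space[OF A] by (intro finite_measure_mono) auto
      also have "\<dots> \<le> measure M (A \<inter> Y) + measure M (space M - Y)"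
        using A Y by (intro measure_Un_le) auto
      finally have AY: "\<alpha> / 4 \<le> measure M (A \<inter> Y)"
        using prob_compl[OF Y] Ybig lo \<alpha> by linarith
      then have "C * measure M (A \<inter> Y) < measure M ((rng_act G K (A \<inter> Y) - A \<inter> Y) \<inter> Y)"
        using exp[of "A \<inter> Y"] A Y True \<alpha>Y by auto
      also have "\<dots> \<le> measure M (rng_act G K A - A)"
        using bd_meas by (intro finite_measure_mono) (auto simp: rng_act_def)
      moreover have "C * (\<alpha> / 4) \<le> C * measure M (A \<inter> Y)"
        using AY C by (intro mult_left_mono) auto
      ultimately show ?thesis by (simp add: c_def)
    next
      case False
      define B where "B = Y - A"
      define E where "E = A \<inter> rng_act G K B"
      have B: "B \<in> sets M" "B \<subseteq> Y" and E: "E \<in> sets M"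
        using A Y act_meas by (auto simp: B_def E_def)
      have split: "measure M B = measure M Y - measure M (A \<inter> Y)"
        using finite_measure_Diff[of Y "A \<inter> Y"] A Y by (simp add: B_def Diff_Int2 Diff_Int)
      moreover have "measure M (A \<inter> Y) \<le> measure M A"
        using A by (intro finite_measure_mono) auto
      ultimately have Blo: "\<alpha> / 4 \<le> measure M B"
        using hi Ybig \<alpha> by linarith
      have "C * measure M B < measure M ((rng_act G K B - B) \<inter> Y)"
        using exp[of B] B Blo \<alpha>Y split False by auto
      also have "\<dots> \<le> measure M E"
        using E by (intro finite_measure_mono) (auto simp: B_def E_def)
      finally have "C * measure M B < measure M E" .
      moreover have "C * (\<alpha> / 4) \<le> C * measure M B"
        using Blo C by (intro mult_left_mono) auto
      ultimately have Ebig: "C * (\<alpha> / 4) < measure M E" by simp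
      have "E \<subseteq> rng_act G K (rng_act G K E \<inter> B)"
      proof
        fix x assume "x \<in> E"
        then obtain g where g: "g \<in> K" "src G g \<in> B" "x = rng G g"
          by (auto simp: E_def rng_act_def)
        have "ginv G g \<in> K" using g sym by blast
        then have "src G g \<in> rng_act G K E"
          using g arr \<open>x \<in> E\<close> unfolding rng_act_def
          by (intro image_eqI[of _ _ "ginv G g"]) (auto simp: rng_ginv src_ginv subset_eq)
        then show "x \<in> rng_act G K (rng_act G K E \<inter> B)"
          using g by (auto simp: rng_act_def)
      qed
      moreover have E': "rng_act G K E \<inter> B \<in> sets M"
        using E B act_meas by auto
      ultimately have "measure M E \<le> measure M (rng_act G K (rng_act G K E \<inter> B))"
        using act_meas by (intro finite_measure_mono) auto
      then have "\<delta> \<le> measure M (rng_act G K E \<inter> B)"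
        using \<delta>(2)[OF E'] Ebig by linarith
      also have "\<dots> \<le> measure M (rng_act G K A - A)"
        using bd_meas by (intro finite_measure_mono) (auto simp: rng_act_def E_def B_def)
      finally show ?thesis by (simp add: c_def)
    qed
    moreover have "c * measure M A \<le> c * (1 / 2)"
      using hi c by (intro mult_left_mono) auto
    ultimately show ?thesis
      unfolding bd_units using c by linarith
  qed
  show "\<exists>C N L K. C > 0 \<and> N > 0 \<and> L > 0 \<and> N_decomposable G l M N K \<and> set_length l K \<le> ennreal L \<and>
      (\<forall>A\<in>sets M. A \<subseteq> units G \<and> \<alpha> * measure M (units G) \<le> measure M A \<and>
         measure M A \<le> 1 / 2 * measure M (units G) \<longrightarrow>
         C * measure M A < measure M ((rng_act G K A - A) \<inter> units G))"
    using c N L K main by (intro exI[of _ c] exI[of _ N] exI[of _ L] exI[of _ K]) (auto simp: measure_units)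
qed

section \<open>From asymptotic expansion to domains of expansion\<close>

text \<open>Sets of measure at least \<open>\<alpha>\<close> have boundary of measure at least \<open>C * \<alpha>\<close>. A truncation that
  loses half of this keeps half of the expansion constant.\<close>

lemma expansion_by_ratio_bounded_family:
  assumes exp: "asymptotically_expanding_in_measure G l M" and \<alpha>: "0 < \<alpha>" "\<alpha> \<le> 1 / 2"
  obtains \<C> \<theta> C where "finite \<C>" "\<And>B. B \<in> \<C> \<Longrightarrow> admissible G l M B"
    "\<theta> \<ge> 1" "\<And>B. B \<in> \<C> \<Longrightarrow> ratio_bounded G M \<theta> B" "C > 0"
    "\<And>A. A \<in> sets M \<Longrightarrow> \<alpha> \<le> measure M A \<Longrightarrow> measure M A \<le> 1 / 2 \<Longrightarrow>
      C * measure M A < measure M (rng_act G (\<Union>\<C>) A - A)"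
proof -
  obtain C and N :: nat and L K where C: "C > 0" and K: "N_decomposable G l M N K"
    and exp: "\<And>A. A \<in> sets M \<Longrightarrow> A \<subseteq> units G \<Longrightarrow> \<alpha> \<le> measure M A \<Longrightarrow>
      measure M A \<le> 1/2 \<Longrightarrow> measure M ((rng_act G K A - A) \<inter> units G) > C * measure M A"
    using exp \<alpha>
    unfolding asymptotically_expanding_in_measure_def domain_of_asymptotic_expansion_def measure_units
    by (metis mult.right_neutral)
  obtain \<B> where \<B>: "finite \<B>" "\<And>B. B \<in> \<B> \<Longrightarrow> admissible G l M B" "K = \<Union>\<B>"
    using K by (auto simp: N_decomposable_def decomposable_def)
  have "C * \<alpha> / 2 > 0" using C \<alpha> by simp
  then obtain \<C> \<theta> where \<C>: "finite \<C>" "\<Union>\<C> \<subseteq> \<Union>\<B>" "\<And>B. B \<in> \<C> \<Longrightarrow> admissible G l M B"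
    and \<theta>: "\<theta> \<ge> 1" "\<And>B. B \<in> \<C> \<Longrightarrow> ratio_bounded G M \<theta> B"
    and tr: "\<And>A. A \<in> sets M \<Longrightarrow> measure M (rng_act G K A - rng_act G (\<Union>\<C>) A) \<le> C * \<alpha> / 2"
    using truncate_family[OF \<B>(1,2), of "C * \<alpha> / 2"] \<B>(3) by metis
  have "C / 2 * measure M A < measure M (rng_act G (\<Union>\<C>) A - A)"
    if A: "A \<in> sets M" "\<alpha> \<le> measure M A" "measure M A \<le> 1 / 2" for A
  proof -
    let ?X = "rng_act G K A - rng_act G (\<Union>\<C>) A" and ?Y = "rng_act G (\<Union>\<C>) A - A"
    have meas: "?X \<in> sets M" "?Y \<in> sets M"
      using A \<B> \<C> by (auto intro!: sets.Diff sets_rng_act_Union)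
    have "C * measure M A < measure M ((rng_act G K A - A) \<inter> units G)"
      using exp[OF A(1)] A sets.sets_into_space[OF A(1)] by (simp add: space_units)
    also have "\<dots> \<le> measure M (?X \<union> ?Y)"
      using meas by (intro finite_measure_mono) auto
    also have "\<dots> \<le> measure M ?X + measure M ?Y"
      using meas by (intro measure_Un_le) auto
    finally have "C * measure M A < C * \<alpha> / 2 + measure M ?Y"
      using tr[OF A(1)] by linarith
    moreover have "C * \<alpha> \<le> C * measure M A"
      using A C by (intro mult_left_mono) auto
    ultimately show ?thesis by simp
  qed
  with that[OF \<C>(1,3) \<theta>, of "C / 2"] C show thesis by auto
qed

text \<open>Sets with small boundary are closed under increasing unions: the parts of the images of
  \<open>F n\<close> outside the union increase to the boundary of the union, and each is contained in the boundary
  of \<open>F n\<close>.\<close>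

lemma exists_maximal_folner_set:
  assumes fin: "finite \<B>" and adm: "\<And>B. B \<in> \<B> \<Longrightarrow> admissible G l M B" and c: "c \<ge> 0"
  defines "folner F \<equiv> F \<in> sets M \<and> measure M F \<le> 1 / 2 \<and>
      measure M (rng_act G (\<Union>\<B>) F - F) \<le> c * measure M F"
  obtains F where "folner F" "\<And>H. folner H \<Longrightarrow> F \<subseteq> H \<Longrightarrow> measure M H \<le> measure M F"
proof (rule exists_maximal_set_up_to_null[of folner "{}"])
  show "folner {}"
    by (simp add: folner_def rng_act_def)
next
  fix F :: "nat \<Rightarrow> 'g set"
  assume inc: "incseq F" and F: "\<And>n. folner (F n)"
  let ?U = "\<Union>n. F n" and ?act = "rng_act G (\<Union>\<B>)"
  have meas: "F n \<in> sets M" for n using F by (simp add: folner_def)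
  have act_meas: "?act (F n) \<in> sets M" for n
    by (rule sets_rng_act_Union[OF fin adm meas])
  have U: "?U \<in> sets M" using meas by auto
  have lim: "(\<lambda>n. measure M (F n)) \<longlonglongrightarrow> measure M ?U"
    using inc meas by (intro finite_Lim_measure_incseq) auto
  then have half: "measure M ?U \<le> 1 / 2"
    using F by (intro LIMSEQ_le_const2) (auto simp: folner_def)
  have "(\<lambda>n. measure M (?act (F n) - ?U)) \<longlonglongrightarrow> measure M (\<Union>n. ?act (F n) - ?U)"
  proof (rule finite_Lim_measure_incseq)
    show "range (\<lambda>n. ?act (F n) - ?U) \<subseteq> sets M" using act_meas U by auto
    show "incseq (\<lambda>n. ?act (F n) - ?U)"
      using inc rng_act_mono[OF order_refl] by (fastforce simp: incseq_def)
  qed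
  moreover have "(\<Union>n. ?act (F n) - ?U) = ?act ?U - ?U"
    by (simp add: rng_act_UN)
  moreover have "measure M (?act (F n) - ?U) \<le> c * measure M ?U" for n
  proof -
    have "measure M (?act (F n) - ?U) \<le> measure M (?act (F n) - F n)"
      using act_meas meas by (intro finite_measure_mono) auto
    also have "\<dots> \<le> c * measure M (F n)"
      using F by (simp add: folner_def)
    also have "\<dots> \<le> c * measure M ?U"
      using U c by (intro mult_left_mono finite_measure_mono) auto
    finally show ?thesis .
  qed
  ultimately have "measure M (?act ?U - ?U) \<le> c * measure M ?U"
    by (intro LIMSEQ_le_const2[of "\<lambda>n. measure M (?act (F n) - ?U)"]) auto
  then show "folner ?U"
    using U half by (simp add: folner_def)
qed (use that in \<open>auto simp: folner_def\<close>)

text \<open>The family \<open>\<C>\<^sub>0\<close> serves the sets of measure at least \<open>1 / 4\<close>. Its constant \<open>C\<^sub>0\<close> is known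
  before \<open>\<alpha>\<close> is chosen, so \<open>\<alpha>\<close> can be made small against it; the constant \<open>C\<^sub>1\<close> at scale \<open>\<alpha>\<close> may be
  far smaller than \<open>\<alpha>\<close> and could not absorb the loss of \<open>F\<close>. Truncation precedes the choice of \<open>F\<close>,
  so the ratio bound holds on the whole source of each bisection.\<close>

lemma exists_domain_of_expansion:
  assumes exp: "asymptotically_expanding_in_measure G l M" and \<epsilon>: "\<epsilon> > 0"
  obtains Y C N L \<theta> where "domain_of_expansion G l M C N L \<theta> Y" "C > 0" "N > 0" "L > 0" "\<theta> \<ge> 1"
    "measure M Y > 1 - \<epsilon>"
proof -
  obtain \<C>\<^sub>0 \<theta>\<^sub>0 C\<^sub>0 where fin0: "finite \<C>\<^sub>0" and adm0: "\<And>B. B \<in> \<C>\<^sub>0 \<Longrightarrow> admissible G l M B"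
    and "\<theta>\<^sub>0 \<ge> 1" and rb0: "\<And>B. B \<in> \<C>\<^sub>0 \<Longrightarrow> ratio_bounded G M \<theta>\<^sub>0 B" and C0: "C\<^sub>0 > 0"
    and exp0: "\<And>A. A \<in> sets M \<Longrightarrow> 1/4 \<le> measure M A \<Longrightarrow> measure M A \<le> 1 / 2 \<Longrightarrow>
      C\<^sub>0 * measure M A < measure M (rng_act G (\<Union>\<C>\<^sub>0) A - A)"
    using expansion_by_ratio_bounded_family[OF exp, of "1/4"] by auto
  define \<alpha> where "\<alpha> = min (1 / 4) (min \<epsilon> (C\<^sub>0 / 8))"
  have \<alpha>: "0 < \<alpha>" "\<alpha> \<le> 1 / 4" "\<alpha> \<le> \<epsilon>" "\<alpha> \<le> C\<^sub>0 / 8"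
    using \<epsilon> C0 by (auto simp: \<alpha>_def)
  obtain \<C>\<^sub>1 \<theta>\<^sub>1 C\<^sub>1 where fin1: "finite \<C>\<^sub>1" and adm1: "\<And>B. B \<in> \<C>\<^sub>1 \<Longrightarrow> admissible G l M B"
    and "\<theta>\<^sub>1 \<ge> 1" and rb1: "\<And>B. B \<in> \<C>\<^sub>1 \<Longrightarrow> ratio_bounded G M \<theta>\<^sub>1 B" and C1: "C\<^sub>1 > 0"
    and exp1: "\<And>A. A \<in> sets M \<Longrightarrow> \<alpha> \<le> measure M A \<Longrightarrow> measure M A \<le> 1 / 2 \<Longrightarrow>
      C\<^sub>1 * measure M A < measure M (rng_act G (\<Union>\<C>\<^sub>1) A - A)"
    using expansion_by_ratio_bounded_family[OF exp, of \<alpha>] \<alpha> by auto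
  define \<theta> where "\<theta> = max \<theta>\<^sub>0 \<theta>\<^sub>1"
  have \<theta>: "\<theta> \<ge> 1" using \<open>\<theta>\<^sub>0 \<ge> 1\<close> by (simp add: \<theta>_def)
  \<comment> \<open>Truncation may destroy symmetry and shrink the unit bisection; both are restored here.\<close>
  define \<B> where "\<B> = insert (units G) (\<C>\<^sub>0 \<union> \<C>\<^sub>1 \<union> (`) (ginv G) ` (\<C>\<^sub>0 \<union> \<C>\<^sub>1))"
  define K where "K = \<Union>\<B>"
  have fin: "finite \<B>" using fin0 fin1 by (simp add: \<B>_def)
  have adm': "admissible G l M B" "ratio_bounded G M \<theta> B" if "B \<in> \<C>\<^sub>0 \<union> \<C>\<^sub>1" for B
    using that adm0 adm1 rb0 rb1
    by (auto simp: \<theta>_def intro: ratio_bounded_mono[OF _ max.cobounded1] ratio_bounded_mono[OF _ max.cobounded2])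
  have adm: "admissible G l M B" if "B \<in> \<B>" for B
    using that adm' admissible_units admissible_ginv unfolding \<B>_def by blast
  have rb: "ratio_bounded G M \<theta> B" if "B \<in> \<B>" for B
    using that adm' ratio_bounded_units[OF \<theta>] ratio_bounded_ginv unfolding \<B>_def by blast
  have sym: "ginv G ` B \<in> \<B>" if "B \<in> \<B>" for B
  proof -
    have inv: "ginv G ` ginv G ` B = B" if "B \<in> \<B>" for B
      using adm[OF that] by (intro ginv_image_ginv_image) (simp add: admissible_iff bisection_def)
    from that consider "B = units G" | "B \<in> \<C>\<^sub>0 \<union> \<C>\<^sub>1" | B' where "B' \<in> \<C>\<^sub>0 \<union> \<C>\<^sub>1" "B = ginv G ` B'"
      unfolding \<B>_def by blast
    then show ?thesis
    proof cases
      case 1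
      then show ?thesis using ginv_image_units by (simp add: \<B>_def)
    next
      case 2
      then show ?thesis unfolding \<B>_def by blast
    next
      case 3
      then have "ginv G ` B = B'" using inv[of B'] by (auto simp: \<B>_def)
      then show ?thesis using 3 unfolding \<B>_def by blast
    qed
  qed
  obtain Ks where Ks: "N_decomposable G l M (card \<B>) K"
    "unital_symmetric_decomposition G l M (card \<B>) Ks K"
    "\<And>i. i \<in> {1..card \<B>} \<Longrightarrow> Ks i \<in> \<B>"
    using N_decomposable_family[OF fin adm _ sym] unfolding K_def
    by (metis \<B>_def insertI1)
  obtain L where L: "L > 0" "set_length l K \<le> ennreal L"
    using finite_set_length_Union[OF fin adm] unfolding K_def by blast
  have act_meas: "rng_act G K A \<in> sets M" if "A \<in> sets M" for A
    unfolding K_def by (rule sets_rng_act_Union[OF fin adm that])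
  have grow: "measure M (rng_act G (\<Union>\<C>) A - A) \<le> measure M (rng_act G K A - A)"
    if "\<C> \<subseteq> \<B>" "A \<in> sets M" for \<C> A
    using that act_meas rng_act_mono[OF Union_mono[OF that(1)] order_refl, of G A]
    by (intro finite_measure_mono) (auto simp: K_def)
  have large: "C\<^sub>0 * measure M A < measure M (rng_act G K A - A)"
    if "A \<in> sets M" "1/4 \<le> measure M A" "measure M A \<le> 1 / 2" for A
    using exp0[OF that] grow[OF _ that(1), of \<C>\<^sub>0] unfolding \<B>_def by fastforce
  have small: "C\<^sub>1 * measure M A < measure M (rng_act G K A - A)"
    if "A \<in> sets M" "\<alpha> \<le> measure M A" "measure M A \<le> 1 / 2" for A
    using exp1[OF that] grow[OF _ that(1), of \<C>\<^sub>1] unfolding \<B>_def by fastforce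
  define c where "c = min C\<^sub>1 (C\<^sub>0 / 2)"
  have c: "c > 0" "c \<le> C\<^sub>1" "c \<le> C\<^sub>0 / 2" using C0 C1 by (auto simp: c_def)
  obtain F where "F \<in> sets M \<and> measure M F \<le> 1 / 2 \<and>
      measure M (rng_act G K F - F) \<le> c * measure M F"
    and maximal: "\<And>H. H \<in> sets M \<and> measure M H \<le> 1 / 2 \<and>
      measure M (rng_act G K H - H) \<le> c * measure M H \<Longrightarrow> F \<subseteq> H \<Longrightarrow> measure M H \<le> measure M F"
    using exists_maximal_folner_set[OF fin adm less_imp_le[OF c(1)]] unfolding K_def by blast
  then have F: "F \<in> sets M" "measure M F \<le> 1 / 2"
      "measure M (rng_act G K F - F) \<le> c * measure M F"
    by auto
  have F_small: "measure M F < \<alpha>"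
  proof (rule ccontr)
    assume "\<not> measure M F < \<alpha>"
    then have "C\<^sub>1 * measure M F < c * measure M F"
      using small[OF F(1)] F by simp
    then show False
      using c mult_right_mono[of c C\<^sub>1 "measure M F"] by simp
  qed
  define Y where "Y = units G - F"
  have Y: "Y \<in> sets M"
    using F unfolding Y_def by (simp flip: space_units)
  have Y_meas: "measure M Y = 1 - measure M F"
    unfolding Y_def using prob_compl[OF F(1)] by (simp add: space_units)
  have exp_Y: "c * measure M A < measure M ((rng_act G K A - A) \<inter> Y)"
    if A: "A \<in> sets M" "A \<subseteq> Y" "0 < measure M A" "measure M A \<le> 1 / 2 * measure M Y" for A
  proof -
    have act_units: "rng_act G K B \<subseteq> units G" for B
      using Ks(1) rng_in_units by (auto simp: rng_act_def N_decomposable_def unital_subset_def)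
    have disj: "A \<inter> F = {}" using A by (auto simp: Y_def)
    have AF: "measure M (A \<union> F) = measure M A + measure M F"
      using A F disj by (intro finite_measure_Union) auto
    have inY: "(rng_act G K A - A) \<inter> Y \<in> sets M"
      using A Y act_meas by auto
    have half: "measure M A \<le> 1 / 2"
      using A(4) prob_le_1[of Y] by linarith
    show ?thesis
    proof (cases "measure M (A \<union> F) \<le> 1 / 2")
      case True
      have "\<not> measure M (rng_act G K (A \<union> F) - (A \<union> F)) \<le> c * measure M (A \<union> F)"
        using maximal[of "A \<union> F"] True A F AF by auto
      then have "c * measure M A + c * measure M F < measure M (rng_act G K (A \<union> F) - (A \<union> F))"
        using AF by (simp add: distrib_left)
      also have "\<dots> \<le> measure M (((rng_act G K A - A) \<inter> Y) \<union> (rng_act G K F - F))"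
        using inY F act_meas act_units
        by (intro finite_measure_mono) (auto simp: rng_act_Un Y_def)
      also have "\<dots> \<le> measure M ((rng_act G K A - A) \<inter> Y) + measure M (rng_act G K F - F)"
        using inY F act_meas by (intro measure_Un_le) auto
      finally show ?thesis using F by simp
    next
      case False
      then have quarter: "1 / 4 \<le> measure M A"
        using AF F_small \<alpha> by simp
      have "C\<^sub>0 * measure M A < measure M (rng_act G K A - A)"
        by (rule large[OF A(1) quarter half])
      also have "\<dots> \<le> measure M (((rng_act G K A - A) \<inter> Y) \<union> F)"
        using inY F act_units by (intro finite_measure_mono) (auto simp: Y_def)
      also have "\<dots> \<le> measure M ((rng_act G K A - A) \<inter> Y) + measure M F"
        using inY F by (intro measure_Un_le) auto
      finally have "C\<^sub>0 * measure M A < measure M ((rng_act G K A - A) \<inter> Y) + C\<^sub>0 / 8"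
        using F_small \<alpha> by simp
      moreover have "C\<^sub>0 * (1 / 4) \<le> C\<^sub>0 * measure M A"
        using quarter C0 by (intro mult_left_mono) auto
      moreover have "c * measure M A \<le> C\<^sub>0 / 2 * measure M A"
        using c by (intro mult_right_mono) auto
      ultimately show ?thesis by simp
    qed
  qed
  have "AE x in M. x \<in> Y \<and> x \<in> src G ` Ks i \<and> tau G (Ks i) x \<in> Y \<longrightarrow>
      ennreal (1 / \<theta>) \<le> rn_ratio G M (Ks i) x \<and> rn_ratio G M (Ks i) x \<le> ennreal \<theta>"
    if "i \<in> {1..card \<B>}" for i
    using AE_rn_ratio_if_ratio_bounded[OF adm[OF Ks(3)[OF that]] rb[OF Ks(3)[OF that]] \<theta>]
    by eventually_elim blast
  then have "domain_of_expansion G l M c (card \<B>) L \<theta> Y"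
    unfolding domain_of_expansion_def using Y Ks(1,2) L(2) exp_Y by blast
  moreover have "card \<B> > 0"
    using fin by (auto simp: card_gt_0_iff \<B>_def)
  moreover have "measure M Y > 1 - \<epsilon>"
    using Y_meas F_small \<alpha> by simp
  ultimately show thesis
    using that c(1) L(1) \<theta> by blast
qed

end

theorem theorem3p10:
  fixes G :: "'g groupoid_data" and l :: "'g \<Rightarrow> real" and M :: "'g measure"
  assumes "groupoid G"
    and "length_function G l"
    and "prob_space M"
    and "space M = units G"
  shows "(asymptotically_expanding_in_measure G l M \<longleftrightarrow>
            (\<exists>(Y :: nat \<Rightarrow> 'g set) (C :: nat \<Rightarrow> real) (N :: nat \<Rightarrow> nat) (L :: nat \<Rightarrow> real) (\<theta> :: nat \<Rightarrow> real).
               exhaustion M Y \<and>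
               (\<forall>n. C n > 0 \<and> N n > 0 \<and> L n > 0 \<and> \<theta> n \<ge> 1 \<and>
                    domain_of_expansion G l M (C n) (N n) (L n) (\<theta> n) (Y n))))
       \<and> (asymptotically_expanding_in_measure G l M \<longleftrightarrow>
            (\<exists>Y :: nat \<Rightarrow> 'g set.
               exhaustion M Y \<and> (\<forall>n. domain_of_asymptotic_expansion G l M (Y n))))"
    (is "(?expanding \<longleftrightarrow> ?by_expansion) \<and> (_ \<longleftrightarrow> ?by_asymptotic)")
proof -
  interpret groupoid G by fact
  interpret prob_space M by fact
  interpret measured_groupoid G M l
    by unfold_locales (fact assms)+
  have close_to_1: "\<exists>n. measure M (Y n) > 1 - \<epsilon>" if "exhaustion M Y" "\<epsilon> > 0" for Y and \<epsilon> :: real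
  proof -
    have "eventually (\<lambda>n. measure M (Y n) > 1 - \<epsilon>) sequentially"
      using that by (intro order_tendstoD(1)[of _ 1]) (auto simp: exhaustion_def)
    then show ?thesis by (auto simp: eventually_sequentially)
  qed
  have "?by_expansion" if exp: ?expanding
  proof -
    have "\<exists>Y C N L \<theta>. domain_of_expansion G l M C N L \<theta> Y \<and> C > 0 \<and> N > 0 \<and> L > 0 \<and> \<theta> \<ge> 1 \<and>
        measure M Y > 1 - 1 / (real n + 1)" for n
      using exists_domain_of_expansion[OF exp, of "1 / (real n + 1)"] by (metis add_pos_nonneg
        divide_pos_pos of_nat_0_le_iff zero_less_one add.commute)
    then obtain Y C N L \<theta> where dom: "\<And>n. domain_of_expansion G l M (C n) (N n) (L n) (\<theta> n) (Y n) \<and>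
        C n > 0 \<and> N n > 0 \<and> L n > 0 \<and> \<theta> n \<ge> 1 \<and> measure M (Y n) > 1 - 1 / (real n + 1)"
      by metis
    have "(\<lambda>n. measure M (Y n)) \<longlonglongrightarrow> 1"
    proof (rule tendsto_sandwich)
      show "eventually (\<lambda>n. 1 - 1 / (real n + 1) \<le> measure M (Y n)) sequentially"
        using dom by (intro always_eventually allI less_imp_le) blast
      show "(\<lambda>n. 1 - 1 / (real n + 1)) \<longlonglongrightarrow> 1"
        using tendsto_diff[OF tendsto_const[of 1] LIMSEQ_inverse_real_of_nat]
        by (simp add: inverse_eq_divide add.commute)
    qed auto
    then have "exhaustion M Y"
      using dom by (auto simp: exhaustion_def domain_of_expansion_def)
    then show ?by_expansion using dom by blast
  qed
  moreover have ?expanding if ?by_expansion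
  proof (rule asymptotically_expanding_if_domains)
    fix \<epsilon> :: real assume "\<epsilon> > 0"
    obtain Y C N L \<theta> where Y: "exhaustion M Y"
      and dom: "\<And>n. C n > 0 \<and> N n > 0 \<and> L n > 0 \<and> \<theta> n \<ge> 1 \<and>
        domain_of_expansion G l M (C n) (N n) (L n) (\<theta> n) (Y n)"
      using \<open>?by_expansion\<close> by metis
    \<comment> \<open>The minimum with \<open>1\<close> keeps \<open>Y n\<close> from being null.\<close>
    obtain n where "measure M (Y n) > 1 - min \<epsilon> 1"
      using close_to_1[OF Y, of "min \<epsilon> 1"] \<open>\<epsilon> > 0\<close> by auto
    then have "measure M (Y n) > 1 - \<epsilon>" "measure M (Y n) > 0" by auto
    then show "\<exists>Y. domain_of_asymptotic_expansion G l M Y \<and> measure M Y > 1 - \<epsilon>"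
      using domain_of_expansion_imp_asymptotic dom by blast
  qed
  moreover have ?by_asymptotic if ?expanding
    using that measure_units
    by (intro exI[of _ "\<lambda>_. units G"])
       (auto simp: asymptotically_expanding_in_measure_def exhaustion_def domain_of_asymptotic_expansion_def)
  moreover have ?expanding if ?by_asymptotic
    using that close_to_1 by (intro asymptotically_expanding_if_domains) blast
  ultimately show ?thesis by blast
qed

end
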